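(* Let $A\in\mathbb{R}^{m\times n}$, let $I\subseteq\{1,\dots,m\}$ and $J\subseteq\{1,\dots,n\}$ be sets of row and column indices with $|I|=|J|=k\le\operatorname{rank}(A)$, let $\epsilon>0$, and let $X\in\mathbb{R}^{k\times n}$ be any matrix (a row space approximator of $A$). Assume that $A(I,J)\in\mathbb{R}^{k\times k}$ is nonsingular and that $X(:,J)\in\mathbb{R}^{k\times k}$ has full row rank. Let $I_0\subseteq\{1,\dots,m\}$ be a set of extra row indices disjoint from $I$ with $|I_0|=p$, and let $$A^{\epsilon}_{I\cup I_0,J}=A(:,J)\,A(I\cup I_0,J)_\epsilon^\dagger\,A(I\cup I_0,:).$$ Let $Q_C\in\mathbb{R}^{m\times k}$ and $Q_X\in\mathbb{R}^{n\times k}$ be matrices with orthonormal columns spanning the column spaces of $C=A(:,J)$ and $X^T$, respectively. Then there is a matrix $E\in\mathbb{R}^{k_\epsilon\times k_\epsilon}$ with $\|E\|_2\le\epsilon$, where $k_\epsilon\le k$ is the number of singular values of $A(I\cup I_0,J)$ smaller than $\epsilon$, such that for any unitarily invariant norm $\|\cdot\|$, $$\|A-A^{\epsilon}_{I\cup I_0,J}\|\le\|Q_C(I\cup I_0,:)^\dagger\|_2\,\|Q_X(J,:)^{-1}\|_2\left(\|A-AX^\dagger X\|+\|E\|\right).$$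
   Context: $A(I,J)$ is the submatrix of $A$ with rows $I$ and columns $J$; $A(:,J)$ and $A(I,:)$ are the submatrices of columns $J$ and rows $I$. $\dagger$ is the Moore–Penrose pseudoinverse and $\|\cdot\|_2$ the spectral norm. For a matrix $B$ and $\epsilon>0$, $B_\epsilon$ is the matrix obtained from $B$ by replacing by zero all singular values of $B$ smaller than $\epsilon$ in its SVD, and $B_\epsilon^\dagger=(B_\epsilon)^\dagger$. A unitarily invariant norm is applied to matrices of different sizes in the usual way, as a fixed symmetric gauge function of the singular values (padded with zeros); the norm of an empty matrix is $0$. *)

theory Defs
  imports
    "Jordan_Normal_Form.DL_Rank_Submatrix"
    "Jordan_Normal_Form.Gauss_Jordan_Elimination"
begin

text \<open>
  The library constant \<open>orthogonal_mat\<close> only asks for pairwise orthogonal nonzero columns;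
  here they have to be orthonormal.
\<close>

definition orthonormal_cols :: "real mat \<Rightarrow> bool" where
  "orthonormal_cols Q \<longleftrightarrow> transpose_mat Q * Q = 1\<^sub>m (dim_col Q)"

definition pinv :: "real mat \<Rightarrow> real mat" where
  "pinv A = (THE P. P \<in> carrier_mat (dim_col A) (dim_row A) \<and>
     A * P * A = A \<and> P * A * P = P \<and>
     transpose_mat (A * P) = A * P \<and> transpose_mat (P * A) = P * A)"

text \<open>The operator norm induced by the Euclidean norms.  As the unit ball always contains the
  zero vector, the norm of an empty matrix is 0.\<close>

definition spectral_norm :: "real mat \<Rightarrow> real" where
  "spectral_norm A =
     (SUP v \<in> {v \<in> carrier_vec (dim_col A). v \<bullet> v \<le> 1}. sqrt ((A *\<^sub>v v) \<bullet> (A *\<^sub>v v)))"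

definition rect_diag :: "nat \<Rightarrow> nat \<Rightarrow> real list \<Rightarrow> real mat" where
  "rect_diag r c \<sigma> = mat r c (\<lambda>(i, j). if i = j then \<sigma> ! i else 0)"

text \<open>Full singular value decomposition: an \<open>r \<times> c\<close> matrix has \<open>min r c\<close> singular values,
  listed with multiplicity in decreasing order (zeros included).\<close>

definition is_svd :: "real mat \<Rightarrow> real mat \<Rightarrow> real list \<Rightarrow> real mat \<Rightarrow> bool" where
  "is_svd B U \<sigma> V \<longleftrightarrow>
     U \<in> carrier_mat (dim_row B) (dim_row B) \<and> orthonormal_cols U \<and>
     V \<in> carrier_mat (dim_col B) (dim_col B) \<and> orthonormal_cols V \<and>
     length \<sigma> = min (dim_row B) (dim_col B) \<and>
     (\<forall>s \<in> set \<sigma>. 0 \<le> s) \<and> sorted_wrt (\<ge>) \<sigma> \<and>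
     B = U * rect_diag (dim_row B) (dim_col B) \<sigma> * transpose_mat V"

definition singular_values :: "real mat \<Rightarrow> real list" where
  "singular_values B = (THE \<sigma>. \<exists>U V. is_svd B U \<sigma> V)"

text \<open>The truncation \<open>B\<^sub>\<epsilon>\<close>.  The factors \<open>U\<close>, \<open>V\<close> of an SVD are not unique, but the
  truncated matrix does not depend on their choice.\<close>

definition sv_truncate :: "real \<Rightarrow> real mat \<Rightarrow> real mat" where
  "sv_truncate \<epsilon> B = (SOME B'. \<exists>U \<sigma> V. is_svd B U \<sigma> V \<and>
     B' = U * rect_diag (dim_row B) (dim_col B) (map (\<lambda>s. if s < \<epsilon> then 0 else s) \<sigma>)
            * transpose_mat V)"

text \<open>A symmetric gauge function is taken on the finitely supported real sequences, so that the
  same function applies to the zero-padded singular values of matrices of all sizes.  No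
  normalisation of the value at a unit vector is imposed.\<close>

definition symmetric_gauge :: "((nat \<Rightarrow> real) \<Rightarrow> real) \<Rightarrow> bool" where
  "symmetric_gauge \<Phi> \<longleftrightarrow>
     (\<forall>x. finite {i. x i \<noteq> 0} \<longrightarrow>
        0 \<le> \<Phi> x \<and>
        (\<Phi> x = 0 \<longleftrightarrow> x = (\<lambda>i. 0)) \<and>
        (\<forall>c. \<Phi> (\<lambda>i. c * x i) = \<bar>c\<bar> * \<Phi> x) \<and>
        (\<forall>y. finite {i. y i \<noteq> 0} \<longrightarrow> \<Phi> (\<lambda>i. x i + y i) \<le> \<Phi> x + \<Phi> y) \<and>
        (\<forall>\<pi>. bij \<pi> \<longrightarrow> \<Phi> (\<lambda>i. x (\<pi> i)) = \<Phi> x) \<and>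
        \<Phi> (\<lambda>i. \<bar>x i\<bar>) = \<Phi> x)"

definition zero_pad :: "real list \<Rightarrow> nat \<Rightarrow> real" where
  "zero_pad xs i = (if i < length xs then xs ! i else 0)"

text \<open>A unitarily invariant norm on real matrices of all sizes: on every space of \<open>r \<times> c\<close>
  matrices it is a norm that is invariant under multiplication by orthogonal matrices, and one
  symmetric gauge function of the singular values gives its values for all sizes.\<close>

definition unitarily_invariant_norm :: "(real mat \<Rightarrow> real) \<Rightarrow> bool" where
  "unitarily_invariant_norm \<nu> \<longleftrightarrow>
     (\<forall>r c. \<forall>M \<in> carrier_mat r c.
        0 \<le> \<nu> M \<and>
        (\<nu> M = 0 \<longleftrightarrow> M = 0\<^sub>m r c) \<and>
        (\<forall>a. \<nu> (a \<cdot>\<^sub>m M) = \<bar>a\<bar> * \<nu> M) \<and>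
        (\<forall>N \<in> carrier_mat r c. \<nu> (M + N) \<le> \<nu> M + \<nu> N) \<and>
        (\<forall>U \<in> carrier_mat r r. \<forall>V \<in> carrier_mat c c.
           orthonormal_cols U \<longrightarrow> orthonormal_cols V \<longrightarrow> \<nu> (U * M * V) = \<nu> M)) \<and>
     (\<exists>\<Phi>. symmetric_gauge \<Phi> \<and> (\<forall>M. \<nu> M = \<Phi> (zero_pad (singular_values M))))"

text \<open>\<open>A(:,J) A(K,J)\<^sub>\<epsilon>\<^sup>\<dagger> A(K,:)\<close>, where \<open>K\<close> and \<open>J\<close> are sets of 0-based row and column indices.\<close>

definition cur_approx :: "real mat \<Rightarrow> real \<Rightarrow> nat set \<Rightarrow> nat set \<Rightarrow> real mat" where
  "cur_approx A \<epsilon> K J =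
     submatrix A UNIV J * pinv (sv_truncate \<epsilon> (submatrix A K J)) * submatrix A K UNIV"

end

theory Submission
  imports
    Defs
    "Jordan_Normal_Form.Char_Poly"
    "HOL-Analysis.Function_Topology"
    "HOL-Analysis.L2_Norm"
begin

text \<open>
  Write \<open>K = I \<union> I\<^sub>0\<close>, \<open>C = A T\<close> for the selected columns and \<open>S A\<close> for the selected rows, with
  selection matrices \<open>S\<close> and \<open>T\<close>, and \<open>G = S C\<close>.  Then \<open>P = C G\<^sub>\<epsilon>\<^sup>\<dagger> S\<close> is idempotent, and with a left inverse \<open>L\<close> of \<open>S Q\<^sub>C\<close> we have
  \<open>C = Q\<^sub>C L G\<close>, hence \<open>P = Q\<^sub>C L (G G\<^sub>\<epsilon>\<^sup>\<dagger>) S\<close> and \<open>\<parallel>1 - P\<parallel>\<^sub>2 \<le> \<parallel>L\<parallel>\<^sub>2\<close>.  Likewise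
  \<open>R = T N\<^sup>T Q\<^sub>X\<^sup>T\<close>, with \<open>N\<close> the inverse of \<open>T\<^sup>T Q\<^sub>X\<close>, is idempotent with \<open>\<parallel>1 - R\<parallel>\<^sub>2 \<le> \<parallel>N\<parallel>\<^sub>2\<close>.
  Split \<open>A - P A = (1 - P) A (1 - R) + (1 - P) A R\<close>.  As \<open>X (1 - R) = 0\<close>, the matrix \<open>A\<close> in the first
  term may be replaced by \<open>A - A X\<^sup>\<dagger> X\<close>.  The second term is
  \<open>Q\<^sub>C L (G - G G\<^sub>\<epsilon>\<^sup>\<dagger> G) N\<^sup>T Q\<^sub>X\<^sup>T\<close>, whose middle factor consists of the small singular values of \<open>G\<close>;
  these form \<open>E\<close>.
\<close>

section \<open>Operator norm bounds\<close>

text \<open>The squared form avoids suprema and square roots, so that bounds compose by plain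
  multiplication. Only \<open>c\<^sup>2\<close> occurs here; the sign of \<open>c\<close> matters
  once it is compared with \<open>spectral_norm\<close>.\<close>

definition op_bounded :: "real \<Rightarrow> real mat \<Rightarrow> bool" where
  "op_bounded c M \<longleftrightarrow>
     (\<forall>v \<in> carrier_vec (dim_col M). (M *\<^sub>v v) \<bullet> (M *\<^sub>v v) \<le> c\<^sup>2 * (v \<bullet> v))"

lemma op_boundedD:
  "op_bounded c M \<Longrightarrow> M \<in> carrier_mat r n \<Longrightarrow> v \<in> carrier_vec n \<Longrightarrow>
    (M *\<^sub>v v) \<bullet> (M *\<^sub>v v) \<le> c\<^sup>2 * (v \<bullet> v)"
  unfolding op_bounded_def by auto

lemma scalar_prod_self: "(v :: real vec) \<bullet> v = (\<Sum>i<dim_vec v. (v $ i)\<^sup>2)"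
  unfolding scalar_prod_def by (simp add: power2_eq_square atLeast0LessThan)

lemma scalar_prod_self_nonneg [simp]: "0 \<le> (v :: real vec) \<bullet> v"
  unfolding scalar_prod_self by (simp add: sum_nonneg)

lemma scalar_prod_self_eq_0: "(v :: real vec) \<bullet> v = 0 \<longleftrightarrow> v = 0\<^sub>v (dim_vec v)"
  unfolding scalar_prod_self by (subst sum_nonneg_eq_0_iff) (auto simp: vec_eq_iff)

lemma scalar_prod_Cauchy_Schwarz:
  fixes v w :: "real vec"
  assumes "dim_vec v = dim_vec w"
  shows "(v \<bullet> w)\<^sup>2 \<le> (v \<bullet> v) * (w \<bullet> w)"
proof -
  let ?S = "{..<dim_vec w}"
  have "\<bar>v \<bullet> w\<bar> \<le> (\<Sum>i\<in>?S. \<bar>v $ i\<bar> * \<bar>w $ i\<bar>)"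
    unfolding scalar_prod_def atLeast0LessThan by (simp flip: abs_mult)
  also have "\<dots> \<le> L2_set (\<lambda>i. v $ i) ?S * L2_set (\<lambda>i. w $ i) ?S"
    by (rule L2_set_mult_ineq)
  also have "\<dots> = sqrt ((v \<bullet> v) * (w \<bullet> w))"
    unfolding L2_set_def scalar_prod_self assms by (simp add: real_sqrt_mult)
  finally have "\<bar>v \<bullet> w\<bar> \<le> sqrt ((v \<bullet> v) * (w \<bullet> w))" .
  then show ?thesis by (metis abs_ge_zero power2_abs sqrt_ge_absD real_sqrt_abs)
qed

lemma mult_mat_vec_scalar_prod:
  fixes M :: "real mat"
  assumes M: "M \<in> carrier_mat r n" and v: "v \<in> carrier_vec n" and w: "w \<in> carrier_vec r"
  shows "(M *\<^sub>v v) \<bullet> w = v \<bullet> (transpose_mat M *\<^sub>v w)"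
  using transpose_vec_mult_scalar[OF M v w] comm_scalar_prod[of "M *\<^sub>v v" r w]
    comm_scalar_prod[of "transpose_mat M *\<^sub>v w" n v] M v w by simp

text \<open>Premises on dimensions instead of carrier sets let the simplifier reassociate long
  products as soon as the dimensions are known.\<close>

lemma mult_mat_assoc:
  "dim_col A = dim_row B \<Longrightarrow> dim_col B = dim_row C \<Longrightarrow> A * B * C = A * (B * (C :: real mat))"
  by (rule assoc_mult_mat) auto

lemma mult_mat_vec_assoc:
  "dim_col A = dim_row B \<Longrightarrow> dim_col B = dim_vec v \<Longrightarrow> (A * B) *\<^sub>v v = A *\<^sub>v (B *\<^sub>v (v :: real vec))"
  by (rule assoc_mult_mat_vec) (auto intro: carrier_vecI)

lemma transpose_mat_mult:
  "dim_col A = dim_row B \<Longrightarrow> transpose_mat (A * B) = transpose_mat B * transpose_mat (A :: real mat)"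
  by (rule transpose_mult) auto

lemma op_bounded_mult:
  assumes dim: "dim_col A = dim_row B" and a: "op_bounded a A" and b: "op_bounded b B"
  shows "op_bounded (a * b) (A * B)"
  unfolding op_bounded_def
proof
  fix v :: "real vec" assume "v \<in> carrier_vec (dim_col (A * B))"
  then have v: "v \<in> carrier_vec (dim_col B)" by simp
  have "(A * B *\<^sub>v v) \<bullet> (A * B *\<^sub>v v) = (A *\<^sub>v (B *\<^sub>v v)) \<bullet> (A *\<^sub>v (B *\<^sub>v v))"
    using dim v by (simp add: mult_mat_vec_assoc)
  also have "\<dots> \<le> a\<^sup>2 * ((B *\<^sub>v v) \<bullet> (B *\<^sub>v v))"
    by (rule op_boundedD[OF a carrier_mat_triv]) (use dim in \<open>auto intro: carrier_vecI\<close>)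
  also have "\<dots> \<le> a\<^sup>2 * (b\<^sup>2 * (v \<bullet> v))"
    by (rule mult_left_mono[OF op_boundedD[OF b carrier_mat_triv v]]) simp
  finally show "(A * B *\<^sub>v v) \<bullet> (A * B *\<^sub>v v) \<le> (a * b)\<^sup>2 * (v \<bullet> v)"
    by (simp add: power_mult_distrib mult.assoc)
qed

text \<open>For \<open>w = A\<^sup>T v\<close>, Cauchy-Schwarz bounds
  \<open>w \<bullet> w = (A w) \<bullet> v\<close> by c |w| |v|, and a factor |w| cancels.\<close>

lemma op_bounded_transpose:
  assumes "op_bounded c A"
  shows "op_bounded c (transpose_mat A)"
  unfolding op_bounded_def
proof
  fix v :: "real vec" assume "v \<in> carrier_vec (dim_col (transpose_mat A))"
  then have v: "v \<in> carrier_vec (dim_row A)" by simp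
  define w where "w = transpose_mat A *\<^sub>v v"
  have A: "A \<in> carrier_mat (dim_row A) (dim_col A)" by simp
  have w: "w \<in> carrier_vec (dim_col A)" unfolding w_def by (rule carrier_vecI) simp
  have "w \<bullet> w = (A *\<^sub>v w) \<bullet> v"
    using mult_mat_vec_scalar_prod[OF A w v] unfolding w_def by simp
  then have "(w \<bullet> w)\<^sup>2 \<le> ((A *\<^sub>v w) \<bullet> (A *\<^sub>v w)) * (v \<bullet> v)"
    using scalar_prod_Cauchy_Schwarz[of "A *\<^sub>v w" v] v by simp
  also have "\<dots> \<le> (c\<^sup>2 * (w \<bullet> w)) * (v \<bullet> v)"
    by (rule mult_right_mono[OF op_boundedD[OF assms A w]]) simp
  finally have *: "(w \<bullet> w) * (w \<bullet> w) \<le> (w \<bullet> w) * (c\<^sup>2 * (v \<bullet> v))"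
    by (simp add: power2_eq_square mult_ac)
  show "w \<bullet> w \<le> c\<^sup>2 * (v \<bullet> v)"
  proof (cases "w \<bullet> w = 0")
    case False
    then have "0 < w \<bullet> w" using scalar_prod_self_nonneg[of w] by linarith
    then show ?thesis using * by simp
  qed simp
qed

lemma orthonormal_cols_isometry:
  assumes "orthonormal_cols Q" and Q: "Q \<in> carrier_mat r n" and v: "v \<in> carrier_vec n"
  shows "(Q *\<^sub>v v) \<bullet> (Q *\<^sub>v v) = v \<bullet> v"
proof -
  have "(Q *\<^sub>v v) \<bullet> (Q *\<^sub>v v) = v \<bullet> (transpose_mat Q *\<^sub>v (Q *\<^sub>v v))"
    by (rule mult_mat_vec_scalar_prod[OF Q v]) (use Q v in simp)
  also have "transpose_mat Q *\<^sub>v (Q *\<^sub>v v) = (transpose_mat Q * Q) *\<^sub>v v"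
    by (rule assoc_mult_mat_vec[symmetric]) (use Q v in auto)
  also have "\<dots> = v" using assms unfolding orthonormal_cols_def by simp
  finally show ?thesis .
qed

lemma orthonormal_cols_op_bounded: "orthonormal_cols Q \<Longrightarrow> op_bounded 1 Q"
  unfolding op_bounded_def using orthonormal_cols_isometry[of Q "dim_row Q" "dim_col Q"] by auto

text \<open>The Frobenius norm is a bound, by Cauchy-Schwarz in each row. This makes the supremum in
  \<open>spectral_norm\<close> finite.\<close>

lemma op_bounded_exists: "\<exists>c \<ge> 0. op_bounded c A"
proof -
  define s where "s = (\<Sum>i<dim_row A. \<Sum>j<dim_col A. (A $$ (i, j))\<^sup>2)"
  have s0: "0 \<le> s" unfolding s_def by (simp add: sum_nonneg)
  have "(A *\<^sub>v v) \<bullet> (A *\<^sub>v v) \<le> (sqrt s)\<^sup>2 * (v \<bullet> v)" if v: "v \<in> carrier_vec (dim_col A)" for v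
  proof -
    have "(A *\<^sub>v v) \<bullet> (A *\<^sub>v v) = (\<Sum>i<dim_row A. (row A i \<bullet> v)\<^sup>2)"
      by (simp add: scalar_prod_self)
    also have "\<dots> \<le> (\<Sum>i<dim_row A. (row A i \<bullet> row A i) * (v \<bullet> v))"
      by (rule sum_mono, rule scalar_prod_Cauchy_Schwarz) (use v in auto)
    also have "\<dots> = s * (v \<bullet> v)"
      by (simp add: s_def sum_distrib_right scalar_prod_self)
    finally show ?thesis using s0 by simp
  qed
  then show ?thesis unfolding op_bounded_def using s0 by (intro exI[of _ "sqrt s"]) auto
qed

lemma spectral_norm_le:
  assumes "op_bounded c A" and "0 \<le> c"
  shows "spectral_norm A \<le> c"
  unfolding spectral_norm_def
proof (rule cSUP_least)
  have "0\<^sub>v (dim_col A) \<in> {v \<in> carrier_vec (dim_col A). v \<bullet> v \<le> (1 :: real)}" by simp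
  then show "{v \<in> carrier_vec (dim_col A). v \<bullet> v \<le> (1 :: real)} \<noteq> {}" by blast
  fix v assume "v \<in> {v \<in> carrier_vec (dim_col A). v \<bullet> v \<le> (1 :: real)}"
  then have "(A *\<^sub>v v) \<bullet> (A *\<^sub>v v) \<le> c\<^sup>2 * (v \<bullet> v)" "v \<bullet> v \<le> 1"
    using assms unfolding op_bounded_def by auto
  then have "(A *\<^sub>v v) \<bullet> (A *\<^sub>v v) \<le> c\<^sup>2"
    using mult_left_mono[of "v \<bullet> v" 1 "c\<^sup>2"] by simp
  then show "sqrt ((A *\<^sub>v v) \<bullet> (A *\<^sub>v v)) \<le> c"
    using assms(2) real_sqrt_le_mono by fastforce
qed

lemma spectral_norm_upper:
  assumes v: "v \<in> carrier_vec (dim_col A)" "v \<bullet> v \<le> 1"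
  shows "sqrt ((A *\<^sub>v v) \<bullet> (A *\<^sub>v v)) \<le> spectral_norm A"
  unfolding spectral_norm_def
proof (rule cSUP_upper)
  obtain c where c: "0 \<le> c" "op_bounded c A" using op_bounded_exists by blast
  show "bdd_above ((\<lambda>v. sqrt ((A *\<^sub>v v) \<bullet> (A *\<^sub>v v))) ` {v \<in> carrier_vec (dim_col A). v \<bullet> v \<le> 1})"
  proof (rule bdd_aboveI2[where M = c])
    fix v assume "v \<in> {v \<in> carrier_vec (dim_col A). v \<bullet> v \<le> (1 :: real)}"
    then have "(A *\<^sub>v v) \<bullet> (A *\<^sub>v v) \<le> c\<^sup>2 * (v \<bullet> v)" "v \<bullet> v \<le> 1"
      using c unfolding op_bounded_def by auto
    then have "(A *\<^sub>v v) \<bullet> (A *\<^sub>v v) \<le> c\<^sup>2"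
      using mult_left_mono[of "v \<bullet> v" 1 "c\<^sup>2"] by simp
    then show "sqrt ((A *\<^sub>v v) \<bullet> (A *\<^sub>v v)) \<le> c"
      using c(1) real_sqrt_le_mono by fastforce
  qed
qed (use v in auto)

lemma spectral_norm_nonneg: "0 \<le> spectral_norm A"
  using spectral_norm_upper[of "0\<^sub>v (dim_col A)" A] order_trans real_sqrt_ge_zero
  by (metis scalar_prod_self_nonneg zero_carrier_vec scalar_prod_left_zero zero_le_one)

text \<open>Homogeneity reduces the claim to unit vectors; the zero vector cannot be normalised and
  is treated apart.\<close>

lemma op_bounded_spectral_norm: "op_bounded (spectral_norm A) A"
  unfolding op_bounded_def
proof
  fix v :: "real vec" assume v: "v \<in> carrier_vec (dim_col A)"
  define t where "t = sqrt (v \<bullet> v)"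
  have tt: "t\<^sup>2 = v \<bullet> v" unfolding t_def by simp
  show "(A *\<^sub>v v) \<bullet> (A *\<^sub>v v) \<le> (spectral_norm A)\<^sup>2 * (v \<bullet> v)"
  proof (cases "t = 0")
    case True
    then have "v = 0\<^sub>v (dim_col A)" using tt scalar_prod_self_eq_0[of v] v by simp
    moreover obtain c where "op_bounded c A" using op_bounded_exists by blast
    ultimately have "(A *\<^sub>v v) \<bullet> (A *\<^sub>v v) \<le> 0"
      using v unfolding op_bounded_def by (metis mult_zero_right scalar_prod_left_zero)
    then show ?thesis by (meson order_trans mult_nonneg_nonneg scalar_prod_self_nonneg zero_le_power2)
  next
    case False
    define u where "u = (1 / t) \<cdot>\<^sub>v v"
    have u: "u \<in> carrier_vec (dim_col A)" unfolding u_def using v by simp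
    have "u \<bullet> u = 1" unfolding u_def using False v
      by (simp flip: tt) (simp add: power2_eq_square)
    then have *: "sqrt ((A *\<^sub>v u) \<bullet> (A *\<^sub>v u)) \<le> spectral_norm A"
      using spectral_norm_upper[OF u] by simp
    have "v = t \<cdot>\<^sub>v u" unfolding u_def using False by (simp add: smult_smult_assoc)
    then have "A *\<^sub>v v = t \<cdot>\<^sub>v (A *\<^sub>v u)" using mult_mat_vec[of A "dim_row A" "dim_col A" u t] u by simp
    then have "(A *\<^sub>v v) \<bullet> (A *\<^sub>v v) = t\<^sup>2 * ((A *\<^sub>v u) \<bullet> (A *\<^sub>v u))"
      by (simp add: power2_eq_square)
    also have "\<dots> \<le> t\<^sup>2 * (spectral_norm A)\<^sup>2"
      by (rule mult_left_mono) (use * in \<open>simp_all add: sqrt_le_D\<close>)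
    finally show ?thesis by (simp add: tt mult.commute)
  qed
qed

text \<open>For an idempotent \<open>P\<close> split \<open>v = a + b\<close> with \<open>a = P v\<close>.  The vector
  \<open>(|b|/|a|) a + (|a|/|b|) b\<close> has the norm of \<open>v\<close>, and \<open>P\<close> maps it to a vector of norm \<open>|b|\<close>.\<close>

lemma op_bounded_complement_idempotent:
  assumes P: "P \<in> carrier_mat n n" and idem: "P * P = P"
    and c: "op_bounded c P" "1 \<le> c"
  shows "op_bounded c (1\<^sub>m n - P)"
  unfolding op_bounded_def
proof
  fix v :: "real vec" assume "v \<in> carrier_vec (dim_col (1\<^sub>m n - P))"
  then have v: "v \<in> carrier_vec n" using P by simp
  define a where "a = P *\<^sub>v v"
  define b where "b = v - a"
  have a: "a \<in> carrier_vec n" unfolding a_def using P v by simp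
  have b: "b \<in> carrier_vec n" unfolding b_def using a v by simp
  have vab: "v = a + b" unfolding b_def using a v by auto
  have Pa: "P *\<^sub>v a = a" unfolding a_def using P v idem by (simp flip: assoc_mult_mat_vec)
  have Pb: "P *\<^sub>v b = 0\<^sub>v n"
    unfolding b_def using P v a Pa by (simp add: mult_minus_distrib_mat_vec) (simp add: a_def[symmetric])
  have eq: "(1\<^sub>m n - P) *\<^sub>v v = b"
    unfolding b_def a_def using P v by (simp add: minus_mult_distrib_mat_vec[of _ n n])
  have c1: "1 \<le> c\<^sup>2" using c(2) by simp
  have ab: "b \<bullet> a = a \<bullet> b" by (rule comm_scalar_prod[OF b a])
  have vv: "v \<bullet> v = a \<bullet> a + 2 * (a \<bullet> b) + b \<bullet> b"
    unfolding vab using a b ab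
    by (simp add: scalar_prod_add_distrib[of _ n] add_scalar_prod_distrib[of _ n])
  \<comment> \<open>The rescaled vector requires both parts to be nonzero. For a = 0 the complement
    fixes \<open>v\<close>, and the bound comes from \<open>1 \<le> c\<close>.\<close>
  have "b \<bullet> b \<le> c\<^sup>2 * (v \<bullet> v)"
  proof (cases "a \<bullet> a = 0 \<or> b \<bullet> b = 0")
    case True
    then consider "a = 0\<^sub>v n" | "b \<bullet> b = 0" using scalar_prod_self_eq_0[of a] a by auto
    then show ?thesis
    proof cases
      case 1
      then have "v \<bullet> v = b \<bullet> b" using vab b by simp
      then show ?thesis using c1 mult_right_mono[of 1 "c\<^sup>2" "b \<bullet> b"] by simp
    qed simp
  next
    case False
    define x y where "x = sqrt (a \<bullet> a)" and "y = sqrt (b \<bullet> b)"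
    have xy: "x\<^sup>2 = a \<bullet> a" "y\<^sup>2 = b \<bullet> b" "x \<noteq> 0" "y \<noteq> 0" using False by (auto simp: x_def y_def)
    define z where "z = (y / x) \<cdot>\<^sub>v a + (x / y) \<cdot>\<^sub>v b"
    have z: "z \<in> carrier_vec n" using a b by (simp add: z_def)
    have Pz: "P *\<^sub>v z = (y / x) \<cdot>\<^sub>v a"
      unfolding z_def using P a b Pa Pb
      by (auto simp: mult_add_distrib_mat_vec[of P n n] mult_mat_vec[of P n n])
    have "(P *\<^sub>v z) \<bullet> (P *\<^sub>v z) = (y / x)\<^sup>2 * (a \<bullet> a)"
      unfolding Pz using a by (simp add: power2_eq_square)
    also have "\<dots> = b \<bullet> b" using xy by (simp add: power_divide flip: xy(1,2))
    finally have 1: "(P *\<^sub>v z) \<bullet> (P *\<^sub>v z) = b \<bullet> b" .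
    have "z \<bullet> z = (y / x)\<^sup>2 * (a \<bullet> a) + 2 * ((y / x) * (x / y)) * (a \<bullet> b) + (x / y)\<^sup>2 * (b \<bullet> b)"
      unfolding z_def using a b ab xy(3,4)
      by (simp add: scalar_prod_add_distrib[of _ n] add_scalar_prod_distrib[of _ n] power2_eq_square field_simps)
    also have "\<dots> = v \<bullet> v" unfolding vv using xy by (simp add: power_divide flip: xy(1,2))
    finally have "z \<bullet> z = v \<bullet> v" .
    then show ?thesis using op_boundedD[OF c(1) P z] 1 by simp
  qed
  then show "((1\<^sub>m n - P) *\<^sub>v v) \<bullet> ((1\<^sub>m n - P) *\<^sub>v v) \<le> c\<^sup>2 * (v \<bullet> v)" unfolding eq .
qed

section \<open>Existence of the singular value decomposition\<close>

lemma mult_mat_unit_vec: "M \<in> carrier_mat r n \<Longrightarrow> i < n \<Longrightarrow> M *\<^sub>v unit_vec n i = col (M :: real mat) i"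
  by (rule eq_vecI) auto

text \<open>Compactness of the unit ball. The ball is moved into
  \<open>nat \<Rightarrow> real\<close> with the product topology: a product of intervals, with the
  coordinates beyond the dimension fixed at 0, is compact, and the norm condition cuts out a closed
  part of it.\<close>

lemma spectral_norm_attained:
  obtains v where "v \<in> carrier_vec (dim_col A)" and "v \<bullet> v \<le> 1"
    and "(A *\<^sub>v v) \<bullet> (A *\<^sub>v v) = (spectral_norm A)\<^sup>2"
proof -
  let ?n = "dim_col A"
  define F where "F = (\<lambda>x :: nat \<Rightarrow> real. \<Sum>i<dim_row A. (\<Sum>j<?n. A $$ (i, j) * x j)\<^sup>2)"
  define S where "S = (\<Pi>\<^sub>E i\<in>UNIV. if i < ?n then {-1..1} else {0}) \<inter> {x :: nat \<Rightarrow> real. (\<Sum>j<?n. (x j)\<^sup>2) \<le> 1}"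
  have F: "(A *\<^sub>v v) \<bullet> (A *\<^sub>v v) = F (\<lambda>i. v $ i)" if "v \<in> carrier_vec ?n" for v
    using that unfolding F_def scalar_prod_self
    by (simp add: scalar_prod_def atLeast0LessThan)
  have "compactin euclidean (\<Pi>\<^sub>E i\<in>UNIV. if i < ?n then {-1..1 :: real} else {0})"
    by (subst euclidean_product_topology[symmetric], subst compactin_PiE) simp
  then have "compact (\<Pi>\<^sub>E i\<in>UNIV. if i < ?n then {-1..1 :: real} else {0})"
    by simp
  moreover have cont: "continuous_on UNIV (\<lambda>x :: nat \<Rightarrow> real. x j)" for j
    by (rule continuous_on_product_coordinates)
  have "closed {x :: nat \<Rightarrow> real. (\<Sum>j<?n. (x j)\<^sup>2) \<le> 1}"
    by (intro closed_Collect_le continuous_intros cont)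
  ultimately have "compact S" unfolding S_def by (rule compact_Int_closed)
  moreover have "(\<lambda>_. 0) \<in> S" unfolding S_def by auto
  moreover have "continuous_on S F"
    unfolding F_def by (intro continuous_intros continuous_on_subset[OF cont]) auto
  ultimately obtain x where x: "x \<in> S" "\<And>y. y \<in> S \<Longrightarrow> F y \<le> F x"
    using continuous_attains_sup[of S F] by blast
  define v where "v = vec ?n x"
  have v: "v \<in> carrier_vec ?n" unfolding v_def by simp
  have vv: "v \<bullet> v \<le> 1" using x(1) unfolding scalar_prod_self v_def S_def by simp
  have Fx: "F x = (A *\<^sub>v v) \<bullet> (A *\<^sub>v v)" unfolding F[OF v] by (simp add: F_def v_def)
  have "spectral_norm A \<le> sqrt (F x)"
    unfolding spectral_norm_def
  proof (rule cSUP_least)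
    have "0\<^sub>v (dim_col A) \<in> {v \<in> carrier_vec (dim_col A). v \<bullet> v \<le> (1 :: real)}" by simp
    then show "{v \<in> carrier_vec (dim_col A). v \<bullet> v \<le> (1 :: real)} \<noteq> {}" by blast
    fix w assume "w \<in> {v \<in> carrier_vec (dim_col A). v \<bullet> v \<le> (1 :: real)}"
    then have w: "w \<in> carrier_vec ?n" "w \<bullet> w \<le> 1" by auto
    define y where "y = (\<lambda>i. if i < ?n then w $ i else 0)"
    have "\<bar>w $ i\<bar> \<le> 1" if "i < ?n" for i
    proof -
      have "(w $ i)\<^sup>2 \<le> (\<Sum>j<?n. (w $ j)\<^sup>2)"
        by (rule member_le_sum) (use that in auto)
      then show ?thesis using w abs_square_le_1[of "w $ i"] unfolding scalar_prod_self by simp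
    qed
    then have "y \<in> S" using w unfolding S_def y_def scalar_prod_self by (auto simp: abs_le_iff) 
    moreover have "F y = (A *\<^sub>v w) \<bullet> (A *\<^sub>v w)" unfolding F[OF w(1)] by (simp add: F_def y_def)
    ultimately show "sqrt ((A *\<^sub>v w) \<bullet> (A *\<^sub>v w)) \<le> sqrt (F x)" using x(2)[of y] by simp
  qed
  moreover have "sqrt (F x) \<le> spectral_norm A" unfolding Fx by (rule spectral_norm_upper[OF v vv])
  ultimately have "sqrt (F x) = spectral_norm A" by linarith
  then have "(spectral_norm A)\<^sup>2 = F x" by (metis Fx real_sqrt_pow2 scalar_prod_self_nonneg)
  then show ?thesis using that[OF v vv] Fx by simp
qed

lemma orthonormal_cols_mult:
  assumes A: "A \<in> carrier_mat r n" and B: "B \<in> carrier_mat n c"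
    and "orthonormal_cols A" "orthonormal_cols B"
  shows "orthonormal_cols (A * B)"
proof -
  have "transpose_mat (A * B) * (A * B) = transpose_mat B * (transpose_mat A * (A * B))"
    using A B by (simp add: transpose_mult[OF A B] assoc_mult_mat[of _ c n _ r _ c])
  also have "transpose_mat A * (A * B) = (transpose_mat A * A) * B"
    using A B by (simp add: assoc_mult_mat[of _ n r _ n _ c])
  also have "\<dots> = B" using assms unfolding orthonormal_cols_def by simp
  finally show ?thesis using assms unfolding orthonormal_cols_def by simp
qed

lemma orthonormal_cols_transpose:
  assumes Q: "Q \<in> carrier_mat n n" and "orthonormal_cols Q"
  shows "orthonormal_cols (transpose_mat Q)" and "Q * transpose_mat Q = 1\<^sub>m n"
proof -
  have "transpose_mat Q * Q = 1\<^sub>m n" using assms unfolding orthonormal_cols_def by simp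
  then show "Q * transpose_mat Q = 1\<^sub>m n"
    using mat_mult_left_right_inverse[of "transpose_mat Q" n Q] Q by simp
  then show "orthonormal_cols (transpose_mat Q)" using Q unfolding orthonormal_cols_def by simp
qed

text \<open>The Householder reflection that exchanges \<open>v\<close> and the first unit vector; if they agree,
  then \<open>w = 0\<close>, and division by zero makes it the identity.\<close>

lemma orthonormal_cols_extend:
  assumes v: "v \<in> carrier_vec (Suc n)" and v1: "v \<bullet> v = (1 :: real)"
  obtains H where "H \<in> carrier_mat (Suc n) (Suc n)" and "orthonormal_cols H" and "col H 0 = v"
proof -
  define w where "w = v - unit_vec (Suc n) 0"
  define t where "t = 2 / (w \<bullet> w)"
  define H where "H = mat (Suc n) (Suc n) (\<lambda>(i, j). (if i = j then 1 else 0) - t * w $ i * w $ j)"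
  have w: "w \<in> carrier_vec (Suc n)" using v by (simp add: w_def)
  have dw: "dim_vec w = Suc n" using w by simp
  have ww: "w \<bullet> w = 2 - 2 * v $ 0"
    unfolding w_def using v v1
    by (simp add: minus_scalar_prod_distrib[of _ "Suc n"] scalar_prod_minus_distrib[of _ "Suc n"])
  have w0: "w $ 0 = v $ 0 - 1" using v by (simp add: w_def)
  have wi: "w $ i = v $ i - (if i = 0 then 1 else 0)" if "i < Suc n" for i
    using v that by (simp add: w_def)
  have tw: "t * (w \<bullet> w) * w $ i = 2 * w $ i" if "i < Suc n" for i
  proof (cases "w \<bullet> w = 0")
    case True
    then have "w = 0\<^sub>v (Suc n)" using scalar_prod_self_eq_0[of w] dw by simp
    then show ?thesis using that by simp
  qed (simp add: t_def)
  \<comment> \<open>This makes the quadratic term cancel the two linear ones in the entries of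
    \<open>H\<^sup>T H\<close>.\<close>
  have tt: "t * t * (w \<bullet> w) = 2 * t" by (cases "w \<bullet> w = 0") (simp_all add: t_def)
  have wsum: "(\<Sum>l<Suc n. c * (w $ l)\<^sup>2) = c * (w \<bullet> w)" for c
    unfolding scalar_prod_self dw sum_distrib_left ..
  have "transpose_mat H * H = 1\<^sub>m (Suc n)"
  proof (rule eq_matI)
    fix i j assume "i < dim_row (1\<^sub>m (Suc n) :: real mat)" "j < dim_col (1\<^sub>m (Suc n) :: real mat)"
    then have ij: "i < Suc n" "j < Suc n" by auto
    have "(transpose_mat H * H) $$ (i, j) =
        (\<Sum>l<Suc n. ((if l = i then 1 else 0) - t * w $ l * w $ i) * ((if l = j then 1 else 0) - t * w $ l * w $ j))"
      using ij by (simp add: H_def scalar_prod_def atLeast0LessThan del: sum.lessThan_Suc)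
    also have "\<dots> = (\<Sum>l<Suc n. (if l = i then if i = j then 1 else 0 else 0)
        - (if l = i then t * w $ l * w $ j else 0) - (if l = j then t * w $ l * w $ i else 0)
        + t * t * w $ i * w $ j * (w $ l)\<^sup>2)"
      by (rule sum.cong[OF refl]) (simp add: algebra_simps power2_eq_square)
    also have "\<dots> = (if i = j then 1 else 0) - 2 * t * w $ i * w $ j + t * t * w $ i * w $ j * (w \<bullet> w)"
      using ij unfolding sum.distrib sum_subtractf
      by (simp add: wsum del: sum.lessThan_Suc)
    also have "\<dots> = (if i = j then 1 else 0)"
      using arg_cong[OF tt, of "\<lambda>x. x * w $ i * w $ j"] by (simp add: mult_ac)
    finally show "(transpose_mat H * H) $$ (i, j) = 1\<^sub>m (Suc n) $$ (i, j)" using ij by simp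
  qed (auto simp: H_def)
  then have "orthonormal_cols H" by (simp add: orthonormal_cols_def H_def)
  moreover have "col H 0 = v"
  proof (rule eq_vecI)
    fix i assume "i < dim_vec v"
    then have i: "i < Suc n" using v by simp
    \<comment> \<open>\<open>ww\<close> and \<open>w0\<close> give
      \<open>w \<bullet> w = - 2 * w $ 0\<close>. So the first column of \<open>H\<close> is the
      first unit vector plus \<open>w\<close>, that is \<open>v\<close>.\<close>
    have "w $ i * w $ 0 * t = - w $ i"
      using tw[OF i] unfolding ww w0 by (simp add: algebra_simps)
    then show "col H 0 $ i = v $ i" using i wi[OF i] by (simp add: H_def mult_ac split: if_splits)
  qed (use v in \<open>simp add: H_def\<close>)
  moreover have "H \<in> carrier_mat (Suc n) (Suc n)" by (simp add: H_def)
  ultimately show ?thesis using that by blast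
qed

text \<open>Deflation brings a matrix into this form. Products, transposes and orthonormality pass
  through the border, so an SVD of the block extends to one of the whole matrix.\<close>

definition bordered :: "real \<Rightarrow> real mat \<Rightarrow> real mat" where
  "bordered a B = four_block_mat (mat 1 1 (\<lambda>_. a)) (0\<^sub>m 1 (dim_col B)) (0\<^sub>m (dim_row B) 1) B"

lemma bordered_carrier [simp]:
  "B \<in> carrier_mat r c \<Longrightarrow> bordered a B \<in> carrier_mat (Suc r) (Suc c)"
  unfolding bordered_def by (rule carrier_matI) auto

lemma dim_bordered:
  "dim_row (bordered a B) = Suc (dim_row B)" "dim_col (bordered a B) = Suc (dim_col B)"
  unfolding bordered_def by auto

lemma bordered_mult:
  assumes A: "A \<in> carrier_mat r n" and B: "B \<in> carrier_mat n c"
  shows "bordered a A * bordered b B = bordered (a * b) (A * B)"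
proof -
  have "mat 1 1 (\<lambda>_. a) * mat 1 1 (\<lambda>_. b) = (mat 1 1 (\<lambda>_. a * b) :: real mat)"
    by (rule eq_matI) (auto simp: scalar_prod_def)
  then show ?thesis
    unfolding bordered_def using A B
    by (subst mult_four_block_mat[of _ 1 1 _ n _ r _ _ 1 _ c]) auto
qed

lemma bordered_transpose: "transpose_mat (bordered a B) = bordered a (transpose_mat B)"
  unfolding bordered_def by (rule eq_matI) auto

lemma bordered_one: "bordered 1 (1\<^sub>m n) = 1\<^sub>m (Suc n)"
  unfolding bordered_def by (rule eq_matI) auto

lemma orthonormal_cols_bordered:
  "orthonormal_cols Q \<Longrightarrow> orthonormal_cols (bordered 1 Q)"
  unfolding orthonormal_cols_def bordered_transpose
  by (subst bordered_mult[of _ "dim_col Q" "dim_row Q" _ "dim_col Q"]) (auto simp: bordered_one dim_bordered)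

lemma rect_diag_Cons: "rect_diag (Suc r) (Suc c) (s # \<sigma>) = bordered s (rect_diag r c \<sigma>)"
  unfolding bordered_def rect_diag_def by (rule eq_matI) (auto simp: nth_Cons split: nat.split)

lemma rect_diag_carrier [simp]: "rect_diag r c \<sigma> \<in> carrier_mat r c"
  "dim_row (rect_diag r c \<sigma>) = r" "dim_col (rect_diag r c \<sigma>) = c"
  unfolding rect_diag_def by auto

lemma bordered_mult_vCons:
  "v \<in> carrier_vec (dim_col B) \<Longrightarrow> bordered a B *\<^sub>v vCons x v = vCons (a * x) (B *\<^sub>v v)"
proof (rule eq_vecI)
  fix i assume v: "v \<in> carrier_vec (dim_col B)" and "i < dim_vec (vCons (a * x) (B *\<^sub>v v))"
  then have i: "i < Suc (dim_row B)" by simp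
  have "(bordered a B *\<^sub>v vCons x v) $ i =
      (\<Sum>j<Suc (dim_col B). bordered a B $$ (i, j) * vCons x v $ j)"
    using i v by (simp add: scalar_prod_def atLeast0LessThan bordered_def del: sum.lessThan_Suc)
  then show "(bordered a B *\<^sub>v vCons x v) $ i = vCons (a * x) (B *\<^sub>v v) $ i"
    using i v by (cases i)
      (simp_all add: sum.lessThan_Suc_shift bordered_def scalar_prod_def atLeast0LessThan del: sum.lessThan_Suc)
qed (simp add: bordered_def)

text \<open>The block is the action on vectors with first coordinate 0. Hence deflation does not
  increase the norm, which keeps the singular values in decreasing order.\<close>

lemma op_bounded_bordered: "op_bounded c (bordered a B) \<Longrightarrow> op_bounded c B"
  unfolding op_bounded_def
proof
  fix v :: "real vec" assume h: "\<forall>v\<in>carrier_vec (dim_col (bordered a B)).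
      (bordered a B *\<^sub>v v) \<bullet> (bordered a B *\<^sub>v v) \<le> c\<^sup>2 * (v \<bullet> v)" and v: "v \<in> carrier_vec (dim_col B)"
  have "vCons 0 v \<in> carrier_vec (dim_col (bordered a B))" using v by (simp add: bordered_def)
  from h[rule_format, OF this] show "(B *\<^sub>v v) \<bullet> (B *\<^sub>v v) \<le> c\<^sup>2 * (v \<bullet> v)"
    by (simp add: bordered_mult_vCons[OF v])
qed

text \<open>Deflation: take unit vectors with \<open>A v = s u\<close> and \<open>s = \<parallel>A\<parallel>\<^sub>2\<close>, and complete them to orthogonal
  matrices.  In these bases the first column is \<open>s\<close> times a unit vector; the transpose has the same
  norm bound, so the rest of the first row vanishes.\<close>

lemma svd_exists_le_spectral_norm:
  "A \<in> carrier_mat r c \<Longrightarrow> \<exists>U \<sigma> V. is_svd A U \<sigma> V \<and> (\<forall>s \<in> set \<sigma>. s \<le> spectral_norm A)"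
proof (induction r arbitrary: A c)
  case 0
  then have "is_svd A (1\<^sub>m 0) [] (1\<^sub>m c)" unfolding is_svd_def orthonormal_cols_def by auto
  then show ?case by fastforce
next
  case (Suc r)
  show ?case
  proof (cases c)
    case 0
    then have "is_svd A (1\<^sub>m (Suc r)) [] (1\<^sub>m 0)" using Suc.prems unfolding is_svd_def orthonormal_cols_def by auto
    then show ?thesis by fastforce
  next
    case (Suc c')
    then have A: "A \<in> carrier_mat (Suc r) (Suc c')" using Suc.prems by simp
    define s where "s = spectral_norm A"
    have s0: "0 \<le> s" unfolding s_def by (rule spectral_norm_nonneg)
    have As: "op_bounded s A" unfolding s_def by (rule op_bounded_spectral_norm)
    obtain u v where v: "v \<in> carrier_vec (Suc c')" "v \<bullet> v = 1"
      and u: "u \<in> carrier_vec (Suc r)" "u \<bullet> u = 1" and Av: "A *\<^sub>v v = s \<cdot>\<^sub>v u"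
    proof (cases "s = 0")
      case True
      \<comment> \<open>A matrix of norm 0 annihilates every vector, so arbitrary unit vectors serve
        as \<open>u\<close> and \<open>v\<close>.\<close>
      have "A *\<^sub>v unit_vec (Suc c') 0 = s \<cdot>\<^sub>v unit_vec (Suc r) 0"
        using op_boundedD[OF As A, of "unit_vec (Suc c') 0"] True A
          scalar_prod_self_eq_0[of "A *\<^sub>v unit_vec (Suc c') 0"]
          scalar_prod_self_nonneg[of "A *\<^sub>v unit_vec (Suc c') 0"] by auto
      then show ?thesis using that[of "unit_vec (Suc c') 0" "unit_vec (Suc r) 0"] by simp
    next
      case False
      obtain v where v: "v \<in> carrier_vec (Suc c')" "v \<bullet> v \<le> 1" "(A *\<^sub>v v) \<bullet> (A *\<^sub>v v) = s\<^sup>2"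
        using spectral_norm_attained[of A] A unfolding s_def by auto
      \<comment> \<open>The maximiser is only known to lie in the unit ball; as s is nonzero, it
        must have length 1.\<close>
      have "s\<^sup>2 \<le> s\<^sup>2 * (v \<bullet> v)" using op_boundedD[OF As A v(1)] v(3) by simp
      then have "v \<bullet> v = 1" using v(2) False by simp
      moreover define u where "u = (1 / s) \<cdot>\<^sub>v (A *\<^sub>v v)"
      have "u \<bullet> u = 1" using v(3) False by (simp add: u_def power2_eq_square)
      moreover have "A *\<^sub>v v = s \<cdot>\<^sub>v u" using False by (simp add: u_def smult_smult_assoc)
      moreover have "u \<in> carrier_vec (Suc r)" unfolding u_def using A v by simp
      ultimately show ?thesis using that v(1) by blast
    qed
    obtain U0 where U0: "U0 \<in> carrier_mat (Suc r) (Suc r)" "orthonormal_cols U0" "col U0 0 = u"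
      using orthonormal_cols_extend[OF u] by blast
    obtain V0 where V0: "V0 \<in> carrier_mat (Suc c') (Suc c')" "orthonormal_cols V0" "col V0 0 = v"
      using orthonormal_cols_extend[OF v] by blast
    define M where "M = transpose_mat U0 * A * V0"
    have M: "M \<in> carrier_mat (Suc r) (Suc c')" unfolding M_def using A U0 V0 by auto
    have "op_bounded (1 * s * 1) M"
      unfolding M_def
      by (intro op_bounded_mult op_bounded_transpose orthonormal_cols_op_bounded As U0(2) V0(2))
        (use A U0 V0 in simp_all)
    then have Ms: "op_bounded s M" by simp
    have unitcol: "transpose_mat U0 *\<^sub>v u = unit_vec (Suc r) 0"
    proof -
      have "transpose_mat U0 *\<^sub>v u = col (transpose_mat U0 * U0) 0"
        unfolding U0(3)[symmetric]
        by (rule col_mult2[symmetric, of _ "Suc r" "Suc r" _ "Suc r"]) (use U0 in auto)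
      then show ?thesis using U0 unfolding orthonormal_cols_def by simp
    qed
    have "col M 0 = (transpose_mat U0 * A) *\<^sub>v v"
      unfolding M_def using A U0 V0 by (subst col_mult2[of _ "Suc r" "Suc c'" _ "Suc c'"]) auto
    also have "\<dots> = s \<cdot>\<^sub>v unit_vec (Suc r) 0"
      using A U0 v u by (simp add: Av assoc_mult_mat_vec[of _ "Suc r" "Suc r"] mult_mat_vec[of _ "Suc r" "Suc r"] unitcol)
    finally have col0: "M $$ (i, 0) = (if i = 0 then s else 0)" if "i < Suc r" for i
      using that M by (metis carrier_matD index_col index_smult_vec(1) index_unit_vec(1,3) mult.right_neutral mult_zero_right zero_less_Suc)
    have row0: "M $$ (0, j) = 0" if j: "0 < j" "j < Suc c'" for j
    proof -
      have "(row M 0) \<bullet> (row M 0) \<le> s\<^sup>2"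
        using op_boundedD[OF op_bounded_transpose[OF Ms], of "Suc c'" "Suc r" "unit_vec (Suc r) 0"] M
        by (simp add: mult_mat_unit_vec[of _ "Suc c'" "Suc r"])
      then have "s\<^sup>2 + (\<Sum>j<c'. (M $$ (0, Suc j))\<^sup>2) \<le> s\<^sup>2"
        unfolding scalar_prod_self using M by (simp add: sum.lessThan_Suc_shift col0 del: sum.lessThan_Suc)
      then have "(\<Sum>j<c'. (M $$ (0, Suc j))\<^sup>2) = 0" by (meson add_le_same_cancel1 order_antisym sum_nonneg zero_le_power2)
      then have "\<forall>j<c'. M $$ (0, Suc j) = 0" by (simp add: sum_nonneg_eq_0_iff)
      then show ?thesis using j by (metis Suc_less_eq gr0_implies_Suc)
    qed
    define B where "B = mat r c' (\<lambda>(i, j). M $$ (Suc i, Suc j))"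
    have B: "B \<in> carrier_mat r c'" by (simp add: B_def)
    have MB: "M = bordered s B"
      by (rule eq_matI) (use M in \<open>auto simp: bordered_def B_def col0 row0\<close>)
    have Bs: "spectral_norm B \<le> s"
      by (rule spectral_norm_le[OF _ s0]) (use Ms in \<open>simp add: MB op_bounded_bordered\<close>)
    \<comment> \<open>The bound by the spectral norm is carried through the induction so that
      \<open>s\<close> can be put in front of a decreasing list.\<close>
    obtain U1 \<sigma> V1 where svd: "is_svd B U1 \<sigma> V1" and le: "\<forall>s \<in> set \<sigma>. s \<le> spectral_norm B"
      using Suc.IH[OF B] by blast
    have U1: "U1 \<in> carrier_mat r r" "orthonormal_cols U1" and V1: "V1 \<in> carrier_mat c' c'" "orthonormal_cols V1"
      and sig: "length \<sigma> = min r c'" "\<forall>s\<in>set \<sigma>. 0 \<le> s" "sorted_wrt (\<ge>) \<sigma>"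
      and Beq: "B = U1 * rect_diag r c' \<sigma> * transpose_mat V1"
      using svd B unfolding is_svd_def by auto
    define U where "U = U0 * bordered 1 U1"
    define V where "V = V0 * bordered 1 V1"
    note bU = bordered_carrier[OF U1(1), of 1] and bV = bordered_carrier[OF V1(1), of 1]
    have U: "U \<in> carrier_mat (Suc r) (Suc r)" "orthonormal_cols U"
      unfolding U_def using U0(1) bU
        orthonormal_cols_mult[OF U0(1) bU U0(2) orthonormal_cols_bordered[OF U1(2)]] by auto
    have V: "V \<in> carrier_mat (Suc c') (Suc c')" "orthonormal_cols V"
      unfolding V_def using V0(1) bV
        orthonormal_cols_mult[OF V0(1) bV V0(2) orthonormal_cols_bordered[OF V1(2)]] by auto
    have "A = (U0 * transpose_mat U0) * A * (V0 * transpose_mat V0)"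
      using A by (simp add: orthonormal_cols_transpose(2)[OF U0(1,2)] orthonormal_cols_transpose(2)[OF V0(1,2)]
        del: assoc_mult_mat)
    also have "\<dots> = U0 * M * transpose_mat V0"
      unfolding M_def using carrier_matD[OF A] carrier_matD[OF U0(1)] carrier_matD[OF V0(1)]
      by (simp add: mult_mat_assoc del: assoc_mult_mat)
    also have "M = bordered 1 U1 * rect_diag (Suc r) (Suc c') (s # \<sigma>) * transpose_mat (bordered 1 V1)"
      unfolding MB Beq rect_diag_Cons bordered_transpose using U1 V1
      by (simp add: bordered_mult[of _ r r _ c'] bordered_mult[of _ r c' _ c'])
    also have "U0 * \<dots> * transpose_mat V0 = U * rect_diag (Suc r) (Suc c') (s # \<sigma>) * transpose_mat V"
      unfolding U_def V_def using carrier_matD[OF U0(1)] carrier_matD[OF V0(1)]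
        carrier_matD[OF bU] carrier_matD[OF bV]
      by (simp add: mult_mat_assoc transpose_mat_mult del: assoc_mult_mat)
    finally have "is_svd A U (s # \<sigma>) V"
      unfolding is_svd_def using A U V sig s0 le Bs by auto
    then show ?thesis using le Bs unfolding s_def by fastforce
  qed
qed

section \<open>Uniqueness of the singular values\<close>

lemma svd_exists: obtains U \<sigma> V where "is_svd A U \<sigma> V"
  using svd_exists_le_spectral_norm[of A "dim_row A" "dim_col A"] by auto

lemma is_svdD:
  assumes "is_svd B U \<sigma> V" and "B \<in> carrier_mat r c"
  shows "U \<in> carrier_mat r r" "orthonormal_cols U" "V \<in> carrier_mat c c" "orthonormal_cols V"
    "length \<sigma> = min r c" "\<And>s. s \<in> set \<sigma> \<Longrightarrow> 0 \<le> s" "sorted_wrt (\<ge>) \<sigma>"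
    "B = U * rect_diag r c \<sigma> * transpose_mat V"
  using assms unfolding is_svd_def by auto

text \<open>Stated for products nested to the right, the normal form under
  \<open>mult_mat_assoc\<close>, so that the two rules together simplify products of
  decompositions.\<close>

lemma orthonormal_cols_cancel:
  assumes "orthonormal_cols Q" and "dim_col Q = dim_row M"
  shows "transpose_mat Q * (Q * M) = M"
  using assms unfolding orthonormal_cols_def by (simp flip: mult_mat_assoc)

text \<open>A diagonal given by a function instead of a list makes products and pseudoinverses
  pointwise; values beyond the diagonal are irrelevant by \<open>fdiag_cong\<close>.\<close>

definition fdiag :: "nat \<Rightarrow> nat \<Rightarrow> (nat \<Rightarrow> real) \<Rightarrow> real mat" where
  "fdiag r c f = mat r c (\<lambda>(i, j). if i = j then f i else 0)"

lemma fdiag_carrier [simp]: "fdiag r c f \<in> carrier_mat r c"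
  "dim_row (fdiag r c f) = r" "dim_col (fdiag r c f) = c"
  unfolding fdiag_def by auto

lemma rect_diag_fdiag: "rect_diag r c \<sigma> = fdiag r c (\<lambda>i. \<sigma> ! i)"
  unfolding fdiag_def rect_diag_def ..

lemma fdiag_cong: "(\<And>i. i < min r c \<Longrightarrow> f i = g i) \<Longrightarrow> fdiag r c f = fdiag r c g"
  unfolding fdiag_def by (rule eq_matI) auto

lemma fdiag_transpose: "transpose_mat (fdiag r c f) = fdiag c r f"
  unfolding fdiag_def by (rule eq_matI) auto

text \<open>The conditional is there for an inner dimension smaller than both outer ones: it cuts
  the diagonal off at \<open>n\<close>.\<close>

lemma fdiag_mult: "fdiag r n f * fdiag n c g = fdiag r c (\<lambda>i. if i < n then f i * g i else 0)"
proof (rule eq_matI)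
  fix i j assume "i < dim_row (fdiag r c (\<lambda>i. if i < n then f i * g i else 0))"
    "j < dim_col (fdiag r c (\<lambda>i. if i < n then f i * g i else 0))"
  then have ij: "i < r" "j < c" by auto
  have "(fdiag r n f * fdiag n c g) $$ (i, j) =
      (\<Sum>l<n. (if i = l then f i else 0) * (if l = j then g l else 0))"
    using ij by (simp add: fdiag_def scalar_prod_def atLeast0LessThan)
  also have "\<dots> = (\<Sum>l<n. if l = i then (if i = j then f i * g i else 0) else 0)"
    by (rule sum.cong) auto
  finally show "(fdiag r n f * fdiag n c g) $$ (i, j) = fdiag r c (\<lambda>i. if i < n then f i * g i else 0) $$ (i, j)"
    using ij by (simp add: fdiag_def)
qed auto

lemma fdiag_minus: "fdiag r c f - fdiag r c g = fdiag r c (\<lambda>i. f i - g i)"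
  unfolding fdiag_def by (rule eq_matI) auto

text \<open>\<open>proots\<close> recovers the roots with their multiplicities from the
  product.\<close>

lemma prod_linear_factors_mset_eq:
  fixes xs ys :: "real list"
  assumes "(\<Prod>a\<leftarrow>xs. [:- a, 1:]) = (\<Prod>a\<leftarrow>ys. [:- a, 1:])"
  shows "mset xs = mset ys"
proof -
  have "proots (\<Prod>a\<leftarrow>zs. [:- a, 1:]) = mset zs" for zs :: "real list"
  proof (induction zs)
    case (Cons z zs)
    have "(\<Prod>a\<leftarrow>zs. [:- a, 1:]) \<noteq> 0" by (auto simp: prod_list_zero_iff)
    then show ?case using Cons by (simp add: proots_mult del: mult_pCons_left)
  qed simp
  then show ?thesis using assms by metis
qed

text \<open>For \<open>B = U D V\<^sup>T\<close> the Gram matrix is similar to the diagonal matrix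
  \<open>D\<^sup>T D\<close>. If there are more columns than rows, the further eigenvalues are zero,
  which is the padding of the list.\<close>

lemma is_svd_gram_char_poly:
  assumes "is_svd B U \<sigma> V"
  shows "char_poly (transpose_mat B * B) =
    (\<Prod>a\<leftarrow>map (\<lambda>x. x\<^sup>2) (\<sigma> @ replicate (dim_col B - length \<sigma>) 0). [:- a, 1:])"
proof -
  define r c where "r = dim_row B" and "c = dim_col B"
  have B: "B \<in> carrier_mat r c" unfolding r_def c_def by simp
  note svd = is_svdD[OF assms B]
  note dims = carrier_matD[OF B] carrier_matD[OF svd(1)] carrier_matD[OF svd(3)]
  let ?G = "fdiag c c (\<lambda>i. if i < r then (\<sigma> ! i)\<^sup>2 else 0)"
  let ?D = "rect_diag r c \<sigma>"
  have "transpose_mat B * B = V * (transpose_mat ?D * ?D) * transpose_mat V"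
    unfolding svd(8) using dims svd(2)
    by (simp add: mult_mat_assoc transpose_mat_mult orthonormal_cols_cancel del: assoc_mult_mat)
  also have "transpose_mat ?D * ?D = ?G"
    unfolding rect_diag_fdiag fdiag_transpose fdiag_mult by (simp only: power2_eq_square)
  finally have "transpose_mat B * B = V * ?G * transpose_mat V" .
  moreover have "V * transpose_mat V = 1\<^sub>m c" "transpose_mat V * V = 1\<^sub>m c"
    using orthonormal_cols_transpose[OF svd(3,4)] svd(3,4) unfolding orthonormal_cols_def by auto
  ultimately have "similar_mat (transpose_mat B * B) ?G"
    using B svd(3) by (intro similar_matI[of _ _ V "transpose_mat V" c]) auto
  then have "char_poly (transpose_mat B * B) = char_poly ?G" by (rule char_poly_similar)
  also have "\<dots> = (\<Prod>a\<leftarrow>diag_mat ?G. [:- a, 1:])"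
    by (rule char_poly_upper_triangular[of _ c]) (auto simp: fdiag_def)
  also have "diag_mat ?G = map (\<lambda>x. x\<^sup>2) (\<sigma> @ replicate (c - length \<sigma>) 0)"
    by (rule nth_equalityI) (auto simp: diag_mat_def fdiag_def nth_append svd(5))
  finally show ?thesis unfolding c_def .
qed

text \<open>The Gram matrix determines the multiset of squared singular values. Square roots recover
  the values, since they are nonnegative, and the decreasing order recovers the list.\<close>

lemma is_svd_unique:
  assumes "is_svd B U \<sigma> V" and "is_svd B U' \<sigma>' V'"
  shows "\<sigma> = \<sigma>'"
proof -
  note svd = is_svdD[OF assms(1) carrier_mat_triv] and svd' = is_svdD[OF assms(2) carrier_mat_triv]
  let ?z = "replicate (dim_col B - length \<sigma>) (0 :: real)"
  have len: "length \<sigma>' = length \<sigma>" using svd(5) svd'(5) by simp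
  have "mset (map (\<lambda>x. x\<^sup>2) (\<sigma> @ ?z)) = mset (map (\<lambda>x. x\<^sup>2) (\<sigma>' @ ?z))"
    using prod_linear_factors_mset_eq is_svd_gram_char_poly[OF assms(1)]
      is_svd_gram_char_poly[OF assms(2)] unfolding len by metis
  then have "mset (map (\<lambda>x. x\<^sup>2) \<sigma>) = mset (map (\<lambda>x. x\<^sup>2) \<sigma>')" by simp
  then have "mset (map sqrt (map (\<lambda>x. x\<^sup>2) \<sigma>)) = mset (map sqrt (map (\<lambda>x. x\<^sup>2) \<sigma>'))"
    by (metis mset_map)
  moreover have "map sqrt (map (\<lambda>x. x\<^sup>2) \<sigma>) = \<sigma>" "map sqrt (map (\<lambda>x. x\<^sup>2) \<sigma>') = \<sigma>'"
    using svd(6) svd'(6) by (auto intro!: map_idI)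
  ultimately have "mset (rev \<sigma>) = mset (rev \<sigma>')" by (simp only: mset_rev)
  moreover have "sorted (rev \<sigma>)" "sorted (rev \<sigma>')"
    using svd(7) svd'(7) by (auto simp: sorted_wrt_rev)
  ultimately have "rev \<sigma> = rev \<sigma>'" by (metis properties_for_sort)
  then show ?thesis by simp
qed

lemma singular_values_eq: "is_svd B U \<sigma> V \<Longrightarrow> singular_values B = \<sigma>"
  unfolding singular_values_def using is_svd_unique by (intro the_equality) blast+

lemma orthonormal_cols_one: "orthonormal_cols (1\<^sub>m n)"
  unfolding orthonormal_cols_def by simp

lemma singular_values_rect_diag:
  assumes "length \<sigma> = min r c" and "\<And>s. s \<in> set \<sigma> \<Longrightarrow> 0 \<le> s" and "sorted_wrt (\<ge>) \<sigma>"
  shows "singular_values (rect_diag r c \<sigma>) = \<sigma>"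
  by (rule singular_values_eq[of _ "1\<^sub>m r" _ "1\<^sub>m c"])
     (use assms in \<open>auto simp: is_svd_def orthonormal_cols_one\<close>)

section \<open>The pseudoinverse\<close>

text \<open>The predicate under the description in \<open>pinv\<close>, named so that existence and
  uniqueness can be treated separately.\<close>

definition penrose :: "real mat \<Rightarrow> real mat \<Rightarrow> bool" where
  "penrose A P \<longleftrightarrow> P \<in> carrier_mat (dim_col A) (dim_row A) \<and>
     A * P * A = A \<and> P * A * P = P \<and>
     transpose_mat (A * P) = A * P \<and> transpose_mat (P * A) = P * A"

text \<open>\<open>A P\<close> and \<open>A Q\<close> are symmetric and each fixes \<open>A\<close>
  from the left, so transposing \<open>A P = (A Q) (A P)\<close> shows that they agree; in the same
  way \<open>P A = Q A\<close>. Then \<open>P = P A P = P A Q = Q A Q = Q\<close>.\<close>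

lemma penrose_unique:
  assumes P: "penrose A P" and Q: "penrose A Q"
  shows "P = Q"
proof -
  have dims: "dim_row P = dim_col A" "dim_col P = dim_row A" "dim_row Q = dim_col A" "dim_col Q = dim_row A"
    using P Q unfolding penrose_def by auto
  note P' = P[unfolded penrose_def] and Q' = Q[unfolded penrose_def]
  have "A * P = A * Q * (A * P)"
    using Q' dims by (metis mult_mat_assoc index_mult_mat(2,3))
  also have "\<dots> = transpose_mat (A * P * (A * Q))"
    using P' Q' dims by (simp add: transpose_mat_mult[of "A * P"] del: assoc_mult_mat)
  also have "A * P * (A * Q) = A * Q"
    using P' dims by (metis mult_mat_assoc index_mult_mat(2,3))
  finally have AP: "A * P = A * Q" using Q' by simp
  have "Q * A = Q * A * (P * A)"
    using P' dims by (metis mult_mat_assoc index_mult_mat(2,3))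
  also have "\<dots> = transpose_mat (P * A * (Q * A))"
    using P' Q' dims by (simp add: transpose_mat_mult[of "P * A"] del: assoc_mult_mat)
  also have "P * A * (Q * A) = P * A"
    using Q' dims by (metis mult_mat_assoc index_mult_mat(2,3))
  finally have QA: "Q * A = P * A" using P' by simp
  have "P = P * (A * P)" using P' dims by (simp add: mult_mat_assoc del: assoc_mult_mat)
  also have "\<dots> = Q * A * Q" unfolding AP QA using dims by (simp add: mult_mat_assoc del: assoc_mult_mat)
  finally show ?thesis using Q' by simp
qed

lemma pinv_eq: "penrose A P \<Longrightarrow> pinv A = P"
  unfolding pinv_def penrose_def[symmetric] using penrose_unique by (intro the_equality) blast+

text \<open>Since \<open>inverse 0 = 0\<close>, entrywise inversion is correct at zero entries too;
  this covers truncated singular values.\<close>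

lemma penrose_fdiag: "penrose (fdiag r c f) (fdiag c r (\<lambda>i. inverse (f i)))"
  unfolding penrose_def fdiag_mult fdiag_transpose
  by (auto intro!: fdiag_cong) (metis right_inverse left_inverse)+

lemma penrose_orthonormal:
  assumes D: "D \<in> carrier_mat r c" and P: "penrose D P"
    and U: "U \<in> carrier_mat r r" "orthonormal_cols U" and V: "V \<in> carrier_mat c c" "orthonormal_cols V"
  shows "penrose (U * D * transpose_mat V) (V * P * transpose_mat U)"
proof -
  have P': "P \<in> carrier_mat (dim_col D) (dim_row D)" and DPD: "D * P * D = D" and PDP: "P * D * P = P"
    and DPt: "transpose_mat (D * P) = D * P" and PDt: "transpose_mat (P * D) = P * D"
    using P unfolding penrose_def by auto
  have dims: "dim_row P = c" "dim_col P = r" "dim_row D = r" "dim_col D = c"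
    "dim_row U = r" "dim_col U = r" "dim_row V = c" "dim_col V = c"
    using D P' U V by auto
  have DP: "U * D * transpose_mat V * (V * P * transpose_mat U) = U * (D * P) * transpose_mat U"
    using dims U(2) V(2) by (simp add: mult_mat_assoc orthonormal_cols_cancel del: assoc_mult_mat)
  have PD: "V * P * transpose_mat U * (U * D * transpose_mat V) = V * (P * D) * transpose_mat V"
    using dims U(2) V(2) by (simp add: mult_mat_assoc orthonormal_cols_cancel del: assoc_mult_mat)
  have 1: "U * (D * P) * transpose_mat U * (U * D * transpose_mat V) = U * (D * P * D) * transpose_mat V"
    using dims U(2) V(2) by (simp add: mult_mat_assoc orthonormal_cols_cancel del: assoc_mult_mat)
  have 2: "V * (P * D) * transpose_mat V * (V * P * transpose_mat U) = V * (P * D * P) * transpose_mat U"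
    using dims U(2) V(2) by (simp add: mult_mat_assoc orthonormal_cols_cancel del: assoc_mult_mat)
  have 3: "transpose_mat (U * (D * P) * transpose_mat U) = U * transpose_mat (D * P) * transpose_mat U"
    using dims by (subst transpose_mat_mult, simp, subst transpose_mat_mult, simp)
      (simp add: mult_mat_assoc del: assoc_mult_mat)
  have 4: "transpose_mat (V * (P * D) * transpose_mat V) = V * transpose_mat (P * D) * transpose_mat V"
    using dims by (subst transpose_mat_mult, simp, subst transpose_mat_mult, simp)
      (simp add: mult_mat_assoc del: assoc_mult_mat)
  have "V * P * transpose_mat U \<in> carrier_mat c r"
    using dims by (intro carrier_matI) simp_all
  then show ?thesis
    unfolding penrose_def DP PD 1 2 3 4 DPD PDP DPt PDt using dims by simp
qed

lemma pinv_orthonormal_fdiag: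
  assumes "U \<in> carrier_mat r r" "orthonormal_cols U" "V \<in> carrier_mat c c" "orthonormal_cols V"
  shows "pinv (U * fdiag r c f * transpose_mat V) = V * fdiag c r (\<lambda>i. inverse (f i)) * transpose_mat U"
  by (rule pinv_eq, rule penrose_orthonormal[OF _ penrose_fdiag]) (use assms in auto)

text \<open>Existence comes from an SVD with inverted diagonal; uniqueness then identifies it with
  the described value.\<close>

lemma penrose_pinv: "penrose A (pinv A)"
proof -
  obtain U \<sigma> V where "is_svd A U \<sigma> V" by (rule svd_exists)
  note svd = is_svdD[OF this carrier_mat_triv]
  have "penrose A (V * fdiag (dim_col A) (dim_row A) (\<lambda>i. inverse (\<sigma> ! i)) * transpose_mat U)"
    by (subst svd(8), subst rect_diag_fdiag, rule penrose_orthonormal[OF _ penrose_fdiag]) (use svd in auto)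
  then show ?thesis using pinv_eq by metis
qed

section \<open>Unitarily invariant norms\<close>

text \<open>No singular value of \<open>W\<close> exceeds the spectral norm and hence
  \<open>c\<close>, so division by \<open>c\<close> leaves a diagonal contraction. Through this form
  a bounded factor is compared with orthogonal matrices.\<close>

lemma contraction_svd:
  assumes W: "W \<in> carrier_mat n n" and c: "op_bounded c W" "0 < c"
  obtains U d V where "U \<in> carrier_mat n n" "orthonormal_cols U" "V \<in> carrier_mat n n" "orthonormal_cols V"
    "\<And>i. i < n \<Longrightarrow> \<bar>d i\<bar> \<le> 1" "W = c \<cdot>\<^sub>m (U * fdiag n n d * transpose_mat V)"
proof -
  obtain U \<sigma> V where svd: "is_svd W U \<sigma> V" and le: "\<forall>s \<in> set \<sigma>. s \<le> spectral_norm W"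
    using svd_exists_le_spectral_norm[OF W] by blast
  note svd = is_svdD[OF svd W]
  have le: "s \<le> c" if "s \<in> set \<sigma>" for s
    using le that spectral_norm_le[OF c(1)] c(2) by fastforce
  have "fdiag n n (\<lambda>i. \<sigma> ! i) = c \<cdot>\<^sub>m fdiag n n (\<lambda>i. \<sigma> ! i / c)"
    by (rule eq_matI) (use c in \<open>auto simp: fdiag_def\<close>)
  then have Weq: "W = c \<cdot>\<^sub>m (U * fdiag n n (\<lambda>i. \<sigma> ! i / c) * transpose_mat V)"
    by (subst svd(8)) (use svd(1,3) in \<open>simp add: rect_diag_fdiag mult_smult_distrib[of U n n _ n]
      mult_smult_assoc_mat[of _ n n _ n] del: assoc_mult_mat\<close>)
  have d: "\<bar>\<sigma> ! i / c\<bar> \<le> 1" if "i < n" for i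
    using that c(2) le[of "\<sigma> ! i"] svd(6)[of "\<sigma> ! i"] svd(5) by simp
  show ?thesis by (rule that[OF svd(1-4) d Weq])
qed

lemma orthonormal_cols_sign:
  assumes "\<And>i. i < n \<Longrightarrow> s i = 1 \<or> s i = (-1 :: real)"
  shows "orthonormal_cols (fdiag n n s)"
proof -
  have "s i * s i = 1" if "i < n" for i
    using assms[OF that] by auto
  then have "fdiag n n s * fdiag n n s = 1\<^sub>m n"
    unfolding fdiag_mult by (intro eq_matI) (auto simp: fdiag_def)
  then show ?thesis unfolding orthonormal_cols_def fdiag_transpose by simp
qed

context
  fixes \<nu> :: "real mat \<Rightarrow> real"
  assumes uin: "unitarily_invariant_norm \<nu>"
begin

lemma uin_smult: "\<nu> (a \<cdot>\<^sub>m M) = \<bar>a\<bar> * \<nu> M"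
  using uin carrier_mat_triv unfolding unitarily_invariant_norm_def by blast

lemma uin_triangle: "M \<in> carrier_mat r c \<Longrightarrow> N \<in> carrier_mat r c \<Longrightarrow> \<nu> (M + N) \<le> \<nu> M + \<nu> N"
  using uin unfolding unitarily_invariant_norm_def by blast

lemma uin_orthonormal:
  "M \<in> carrier_mat r c \<Longrightarrow> U \<in> carrier_mat r r \<Longrightarrow> V \<in> carrier_mat c c \<Longrightarrow>
    orthonormal_cols U \<Longrightarrow> orthonormal_cols V \<Longrightarrow> \<nu> (U * M * V) = \<nu> M"
  using uin unfolding unitarily_invariant_norm_def by blast

text \<open>The gauge function enters through this fact, which compares norms of matrices of
  different sizes.\<close>

lemma uin_singular_values:
  "zero_pad (singular_values M) = zero_pad (singular_values N) \<Longrightarrow> \<nu> M = \<nu> N"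
  using uin unfolding unitarily_invariant_norm_def by metis

text \<open>A diagonal contraction is a convex combination of sign matrices; the induction splits one
  diagonal entry \<open>t\<close> at a time as \<open>(1 + t)/2 * 1 + (1 - t)/2 * (-1)\<close>.\<close>

lemma uin_fdiag_contraction:
  assumes L: "L \<in> carrier_mat r n" and R: "R \<in> carrier_mat n c"
    and sign: "\<And>s. (\<And>i. i < n \<Longrightarrow> s i = 1 \<or> s i = -1) \<Longrightarrow> \<nu> (L * fdiag n n s * R) \<le> b"
    and d: "\<And>i. i < n \<Longrightarrow> \<bar>d i\<bar> \<le> 1"
  shows "\<nu> (L * fdiag n n d * R) \<le> b"
proof -
  \<comment> \<open>Induction on the number \<open>j\<close> of leading entries that may still be
    arbitrary; all later ones are signs. The claim is the case \<open>j = n\<close>.\<close>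
  have "\<nu> (L * fdiag n n d * R) \<le> b"
    if "\<forall>i<n. \<bar>d i\<bar> \<le> 1" "\<forall>i<n. j \<le> i \<longrightarrow> d i = 1 \<or> d i = -1" for j d
    using that
  proof (induction j arbitrary: d)
    case 0
    then show ?case using sign by auto
  next
    case (Suc j)
    show ?case
    proof (cases "j < n")
      case False
      then show ?thesis using Suc by auto
    next
      case True
      define a where "a = (1 + d j) / 2"
      have a: "0 \<le> a" "a \<le> 1" using Suc.prems(1) True unfolding a_def by (auto simp: abs_le_iff)
      let ?F1 = "fdiag n n (d(j := 1))" and ?F2 = "fdiag n n (d(j := -1))"
      have IH: "\<nu> (L * ?F1 * R) \<le> b" "\<nu> (L * ?F2 * R) \<le> b"
        using Suc.prems by (auto intro!: Suc.IH simp: Suc_le_eq) (metis le_neq_implies_less)+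
      have "fdiag n n d = a \<cdot>\<^sub>m ?F1 + (1 - a) \<cdot>\<^sub>m ?F2"
        by (rule eq_matI) (auto simp: fdiag_def a_def field_simps)
      then have "L * fdiag n n d * R = a \<cdot>\<^sub>m (L * ?F1 * R) + (1 - a) \<cdot>\<^sub>m (L * ?F2 * R)"
        using L R
        by (simp add: mult_add_distrib_mat[of L r n _ n] add_mult_distrib_mat[of _ r n _ R c]
          mult_smult_distrib[of L r n _ n] mult_smult_assoc_mat[of _ r n R c] del: assoc_mult_mat)
      moreover have "L * fdiag n n f * R \<in> carrier_mat r c" for f
        using L R by (intro mult_carrier_mat[of _ r n]) auto
      ultimately have "\<nu> (L * fdiag n n d * R) \<le> \<nu> (a \<cdot>\<^sub>m (L * ?F1 * R)) + \<nu> ((1 - a) \<cdot>\<^sub>m (L * ?F2 * R))"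
        by (simp add: uin_triangle[of _ r c])
      also have "\<dots> = a * \<nu> (L * ?F1 * R) + (1 - a) * \<nu> (L * ?F2 * R)"
        using a by (simp add: uin_smult)
      also have "\<dots> \<le> a * b + (1 - a) * b"
        using a IH by (intro add_mono mult_left_mono) auto
      finally show ?thesis by (simp add: algebra_simps)
    qed
  qed
  from this[of d n] show ?thesis using d by auto
qed

text \<open>Up to the factor \<open>c\<close>, \<open>W\<close> is \<open>U d V\<^sup>T\<close> with
  a diagonal contraction \<open>d\<close>. If \<open>d\<close> consists of signs, this is orthogonal
  and preserves the norm; convexity extends the bound to all \<open>d\<close>.\<close>

lemma uin_mult_left:
  assumes W: "W \<in> carrier_mat r r" and M: "M \<in> carrier_mat r n" and c: "op_bounded c W" "0 < c"
  shows "\<nu> (W * M) \<le> c * \<nu> M"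
proof -
  obtain U d V where U: "U \<in> carrier_mat r r" "orthonormal_cols U"
    and V: "V \<in> carrier_mat r r" "orthonormal_cols V"
    and d: "\<And>i. i < r \<Longrightarrow> \<bar>d i\<bar> \<le> 1" and Weq: "W = c \<cdot>\<^sub>m (U * fdiag r r d * transpose_mat V)"
    using contraction_svd[OF W c] by blast
  note dims = carrier_matD[OF U(1)] carrier_matD[OF V(1)] carrier_matD[OF M]
  have "\<nu> (U * fdiag r r d * (transpose_mat V * M)) \<le> \<nu> M"
  proof (rule uin_fdiag_contraction[OF _ _ _ d])
    fix s :: "nat \<Rightarrow> real" assume s: "\<And>i. i < r \<Longrightarrow> s i = 1 \<or> s i = -1"
    let ?O = "U * fdiag r r s * transpose_mat V"
    have "orthonormal_cols ?O"
      using U V by (intro orthonormal_cols_mult[of _ r r _ r] mult_carrier_mat[of _ r r]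
        orthonormal_cols_transpose(1)[of _ r] orthonormal_cols_sign s) auto
    then have "\<nu> (?O * M * 1\<^sub>m n) = \<nu> M"
      using U V by (intro uin_orthonormal[OF M] orthonormal_cols_one) (auto intro!: mult_carrier_mat[of _ r r])
    then show "\<nu> (U * fdiag r r s * (transpose_mat V * M)) \<le> \<nu> M"
      using dims by (simp add: mult_mat_assoc del: assoc_mult_mat)
  qed (use U V M in auto)
  moreover have "W * M = c \<cdot>\<^sub>m (U * fdiag r r d * (transpose_mat V * M))"
    unfolding Weq using U V M dims
    by (subst mult_smult_assoc_mat[of _ r r _ n]) (auto simp: mult_mat_assoc simp del: assoc_mult_mat)
  ultimately show ?thesis using c(2) by (simp add: uin_smult)
qed

lemma uin_mult_right:
  assumes W: "W \<in> carrier_mat n n" and M: "M \<in> carrier_mat r n" and c: "op_bounded c W" "0 < c"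
  shows "\<nu> (M * W) \<le> c * \<nu> M"
proof -
  obtain U d V where U: "U \<in> carrier_mat n n" "orthonormal_cols U"
    and V: "V \<in> carrier_mat n n" "orthonormal_cols V"
    and d: "\<And>i. i < n \<Longrightarrow> \<bar>d i\<bar> \<le> 1" and Weq: "W = c \<cdot>\<^sub>m (U * fdiag n n d * transpose_mat V)"
    using contraction_svd[OF W c] by blast
  note dims = carrier_matD[OF U(1)] carrier_matD[OF V(1)] carrier_matD[OF M]
  have "\<nu> (M * U * fdiag n n d * transpose_mat V) \<le> \<nu> M"
  proof (rule uin_fdiag_contraction[OF _ _ _ d])
    fix s :: "nat \<Rightarrow> real" assume s: "\<And>i. i < n \<Longrightarrow> s i = 1 \<or> s i = -1"
    let ?O = "U * fdiag n n s * transpose_mat V"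
    have "orthonormal_cols ?O"
      using U V by (intro orthonormal_cols_mult[of _ n n _ n] mult_carrier_mat[of _ n n]
        orthonormal_cols_transpose(1)[of _ n] orthonormal_cols_sign s) auto
    then have "\<nu> (1\<^sub>m r * M * ?O) = \<nu> M"
      using U V by (intro uin_orthonormal[OF M] orthonormal_cols_one) (auto intro!: mult_carrier_mat[of _ n n])
    then show "\<nu> (M * U * fdiag n n s * transpose_mat V) \<le> \<nu> M"
      using dims by (simp add: mult_mat_assoc del: assoc_mult_mat)
  qed (use U V M in auto)
  moreover have "M * W = c \<cdot>\<^sub>m (M * U * fdiag n n d * transpose_mat V)"
    unfolding Weq using U V M dims
    by (subst mult_smult_distrib[of _ r n _ n]) (auto simp: mult_mat_assoc simp del: assoc_mult_mat)
  ultimately show ?thesis using c(2) by (simp add: uin_smult)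
qed

lemma uin_mult_both:
  assumes W: "W \<in> carrier_mat r r" "op_bounded a W" "0 < a"
    and M: "M \<in> carrier_mat r n" and Z: "Z \<in> carrier_mat n n" "op_bounded b Z" "0 < b"
  shows "\<nu> (W * M * Z) \<le> a * b * \<nu> M"
proof -
  have "\<nu> (W * M * Z) \<le> b * \<nu> (W * M)"
    by (rule uin_mult_right[OF Z(1) _ Z(2,3)]) (use W M in auto)
  also have "\<dots> \<le> b * (a * \<nu> M)"
    using uin_mult_left[OF W(1) M W(2,3)] Z(3) by simp
  finally show ?thesis by (simp add: mult_ac)
qed

end

section \<open>Selection matrices\<close>

text \<open>One family for row selections, for shifts of a diagonal block and for square diagonal
  matrices, so that they share one norm bound.\<close>

definition partial_perm :: "nat \<Rightarrow> nat \<Rightarrow> nat set \<Rightarrow> (nat \<Rightarrow> nat) \<Rightarrow> (nat \<Rightarrow> real) \<Rightarrow> real mat" where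
  "partial_perm r c S f g = mat r c (\<lambda>(i, l). if i \<in> S \<and> l = f i then g i else 0)"

lemma partial_perm_carrier [simp]: "partial_perm r c S f g \<in> carrier_mat r c"
  "dim_row (partial_perm r c S f g) = r" "dim_col (partial_perm r c S f g) = c"
  unfolding partial_perm_def by auto

lemma partial_perm_mult_index:
  assumes "i < r" and "j < dim_col M" and "dim_row M = c" and f: "i \<in> S \<Longrightarrow> f i < c"
  shows "(partial_perm r c S f g * M) $$ (i, j) = (if i \<in> S then g i * M $$ (f i, j) else 0)"
proof -
  have "(partial_perm r c S f g * M) $$ (i, j) = (\<Sum>l<c. (if i \<in> S \<and> l = f i then g i else 0) * M $$ (l, j))"
    using assms by (simp add: partial_perm_def scalar_prod_def atLeast0LessThan)
  also have "\<dots> = (\<Sum>l<c. if l = f i then (if i \<in> S then g i * M $$ (l, j) else 0) else 0)"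
    by (rule sum.cong) auto
  finally show ?thesis using f by auto
qed

text \<open>As \<open>f\<close> is injective, every coordinate of the vector is used at most once,
  with a weight of modulus at most \<open>b\<close>.\<close>

lemma op_bounded_partial_perm:
  assumes S: "S \<subseteq> {..<r}" and f: "f ` S \<subseteq> {..<c}" "inj_on f S" and g: "\<And>i. i \<in> S \<Longrightarrow> \<bar>g i\<bar> \<le> b"
  shows "op_bounded b (partial_perm r c S f g)"
  unfolding op_bounded_def
proof
  let ?M = "partial_perm r c S f g"
  fix v :: "real vec" assume "v \<in> carrier_vec (dim_col ?M)"
  then have v: "dim_vec v = c" by simp
  have idx: "(?M *\<^sub>v v) $ i = (if i \<in> S then g i * v $ f i else 0)" if "i < r" for i
  proof -
    have "(?M *\<^sub>v v) $ i = (\<Sum>l<c. (if i \<in> S \<and> l = f i then g i else 0) * v $ l)"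
      using that v by (simp add: partial_perm_def scalar_prod_def atLeast0LessThan)
    also have "\<dots> = (\<Sum>l<c. if l = f i then (if i \<in> S then g i * v $ l else 0) else 0)"
      by (rule sum.cong) auto
    finally show ?thesis using f(1) by auto
  qed
  have fin: "finite S" using S finite_subset by blast
  have "(?M *\<^sub>v v) \<bullet> (?M *\<^sub>v v) = (\<Sum>i<r. if i \<in> S then (g i)\<^sup>2 * (v $ f i)\<^sup>2 else 0)"
    unfolding scalar_prod_self by (rule sum.cong) (auto simp: idx power_mult_distrib simp del: index_mult_mat_vec)
  also have "\<dots> = (\<Sum>i\<in>S. (g i)\<^sup>2 * (v $ f i)\<^sup>2)"
    using S by (simp add: sum.If_cases Int_absorb1)
  also have "\<dots> \<le> (\<Sum>i\<in>S. b\<^sup>2 * (v $ f i)\<^sup>2)"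
    by (intro sum_mono mult_right_mono abs_le_square_iff[THEN iffD1] order_trans[OF g abs_ge_self]) auto
  also have "\<dots> = b\<^sup>2 * (\<Sum>l\<in>f ` S. (v $ l)\<^sup>2)"
    by (simp add: sum.reindex[OF f(2)] sum_distrib_left)
  also have "\<dots> \<le> b\<^sup>2 * (\<Sum>l<c. (v $ l)\<^sup>2)"
    using f(1) by (intro mult_left_mono sum_mono2) auto
  finally show "(?M *\<^sub>v v) \<bullet> (?M *\<^sub>v v) \<le> b\<^sup>2 * (v \<bullet> v)"
    unfolding scalar_prod_self[of v] v .
qed

lemma op_bounded_fdiag:
  assumes "\<And>i. i < n \<Longrightarrow> \<bar>f i\<bar> \<le> b"
  shows "op_bounded b (fdiag n n f)"
proof -
  have "fdiag n n f = partial_perm n n {..<n} (\<lambda>i. i) f"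
    unfolding fdiag_def partial_perm_def by (rule eq_matI) auto
  then show ?thesis using op_bounded_partial_perm[of "{..<n}" n "\<lambda>i. i" n f b] assms by simp
qed

text \<open>Submatrices become matrix products, so that associativity and operator bounds apply to
  them.\<close>

definition row_selection :: "nat \<Rightarrow> nat set \<Rightarrow> real mat" where
  "row_selection m K = partial_perm (card K) m {..<card K} (pick K) (\<lambda>_. 1)"

lemma row_selection_carrier [simp]: "row_selection m K \<in> carrier_mat (card K) m"
  "dim_row (row_selection m K) = card K" "dim_col (row_selection m K) = m"
  unfolding row_selection_def by auto

lemma pick_lt: "K \<subseteq> {0..<m} \<Longrightarrow> i < card K \<Longrightarrow> pick K i < (m :: nat)"
  using pick_in_set[of i K] by auto

lemma inj_on_pick: "inj_on (pick K) {..<card K}"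
  by (intro linorder_inj_onI) (auto dest: pick_mono[rotated])

lemma op_bounded_row_selection:
  assumes "K \<subseteq> {0..<m}"
  shows "op_bounded 1 (row_selection m K)"
  unfolding row_selection_def
  by (rule op_bounded_partial_perm) (use assms pick_lt inj_on_pick in auto)

lemma row_selection_mult_index:
  assumes "K \<subseteq> {0..<m}" and "i < card K" and "j < dim_col M" and "dim_row M = m"
  shows "(row_selection m K * M) $$ (i, j) = M $$ (pick K i, j)"
  unfolding row_selection_def
  using assms pick_lt[OF assms(1,2)] by (subst partial_perm_mult_index) auto

lemma Collect_lt_subset: "K \<subseteq> {0..<m} \<Longrightarrow> {i. i < (m :: nat) \<and> i \<in> K} = K"
  by auto

lemma submatrix_rows:
  assumes "M \<in> carrier_mat m n" and "K \<subseteq> {0..<m}"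
  shows "submatrix M K UNIV = row_selection m K * M"
  by (rule eq_matI)
     (use assms in \<open>auto simp: dim_submatrix submatrix_index pick_UNIV row_selection_mult_index Collect_lt_subset
       simp del: index_mult_mat(1)\<close>)

lemma submatrix_cols:
  assumes "M \<in> carrier_mat m n" and "J \<subseteq> {0..<n}"
  shows "submatrix M UNIV J = M * transpose_mat (row_selection n J)"
proof -
  have "submatrix M UNIV J = transpose_mat (submatrix (transpose_mat M) J UNIV)"
    by (rule eq_matI)
       (use assms pick_lt in \<open>auto simp: dim_submatrix submatrix_index pick_UNIV Collect_lt_subset\<close>)
  also have "submatrix (transpose_mat M) J UNIV = row_selection n J * transpose_mat M"
    by (rule submatrix_rows[of _ n m]) (use assms in auto)
  finally show ?thesis using assms by (simp add: transpose_mat_mult)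
qed

lemma submatrix_rows_cols:
  assumes "M \<in> carrier_mat m n" and "K \<subseteq> {0..<m}" and "J \<subseteq> {0..<n}"
  shows "submatrix M K J = row_selection m K * (M * transpose_mat (row_selection n J))"
proof -
  have "submatrix M K J = submatrix (submatrix M UNIV J) K UNIV" by (rule submatrix_split)
  also have "\<dots> = row_selection m K * submatrix M UNIV J"
    by (rule submatrix_rows[of _ m "card J"]) (use assms in \<open>auto simp: submatrix_cols\<close>)
  finally show ?thesis using assms by (simp add: submatrix_cols)
qed

section \<open>The truncated CUR approximation\<close>

lemma mult_mat_minus_distrib:
  "dim_col A = dim_row B \<Longrightarrow> dim_row B = dim_row C \<Longrightarrow> dim_col B = dim_col C \<Longrightarrow>
    A * (B - C) = A * B - A * (C :: real mat)"
  by (rule mult_minus_distrib_mat[of _ "dim_row A" "dim_col A" _ "dim_col B"]) auto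

lemma minus_mat_mult_distrib:
  "dim_row A = dim_row B \<Longrightarrow> dim_col A = dim_col B \<Longrightarrow> dim_col B = dim_row C \<Longrightarrow>
    (A - B) * C = A * C - B * (C :: real mat)"
  by (rule minus_mult_distrib_mat[of _ "dim_row A" "dim_col A" _ _ "dim_col C"]) auto

text \<open>Once an entry of a decreasing list is below \<open>e\<close>, so are all later ones: the
  small entries form a suffix.\<close>

lemma filter_less_drop:
  assumes "sorted_wrt (\<ge>) (xs :: real list)"
  shows "filter (\<lambda>s. s < e) xs = drop (length xs - length (filter (\<lambda>s. s < e) xs)) xs"
  using assms
proof (induction xs)
  case (Cons x xs)
  show ?case
  proof (cases "x < e")
    case True
    then have "filter (\<lambda>s. s < e) xs = xs" using Cons.prems by (auto intro!: filter_True)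
    then show ?thesis using True by simp
  next
    case False
    have "length (filter (\<lambda>s. s < e) xs) \<le> length xs" by simp
    then show ?thesis using False Cons by (simp add: Suc_diff_le)
  qed
qed simp

lemma nth_less_iff_filter:
  assumes "sorted_wrt (\<ge>) (xs :: real list)" and "i < length xs"
  shows "xs ! i < e \<longleftrightarrow> length xs - length (filter (\<lambda>s. s < e) xs) \<le> i"
  using assms
proof (induction xs arbitrary: i)
  case (Cons x xs)
  show ?case
  proof (cases "x < e")
    case True
    then have "filter (\<lambda>s. s < e) xs = xs" using Cons.prems by (auto intro!: filter_True)
    moreover have "(x # xs) ! i \<le> x" using Cons.prems by (cases i) auto
    ultimately show ?thesis using True by simp
  next
    case False
    have "length (filter (\<lambda>s. s < e) xs) \<le> length xs" by simp
    then show ?thesis using False Cons by (cases i) (auto simp: Suc_diff_le)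
  qed
qed simp

text \<open>\<open>E\<close> has its own size, so the block of small singular values has to be moved to the top left
  corner before the sizes can be changed by zero padding.\<close>

lemma fdiag_shift:
  fixes h :: "nat \<Rightarrow> real"
  assumes "\<And>i. i < j \<Longrightarrow> h i = 0" and rm: "r \<le> m" and cn: "c \<le> n" and "l = min r c"
  shows "fdiag r c h =
    partial_perm r m {j..<l} (\<lambda>i. i - j) (\<lambda>_. 1) * fdiag m n (\<lambda>i. if j + i < l then h (j + i) else 0)
      * transpose_mat (partial_perm c n {j..<l} (\<lambda>i. i - j) (\<lambda>_. 1))"
    (is "_ = ?N * ?D * transpose_mat ?M")
proof (rule eq_matI)
  fix a b assume "a < dim_row (?N * ?D * transpose_mat ?M)" "b < dim_col (?N * ?D * transpose_mat ?M)"
  then have ab: "a < r" "b < c" by auto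
  have ND: "(?N * ?D) $$ (a, y) = (if a \<in> {j..<l} then ?D $$ (a - j, y) else 0)" if "y < n" for y
    using ab that rm by (subst partial_perm_mult_index) auto
  have bj: "b - j < n" using ab cn by simp
  define Q where "Q = ?N * ?D"
  have Q: "dim_row Q = r" "dim_col Q = n" unfolding Q_def by auto
  have "(Q * transpose_mat ?M) $$ (a, b) =
      (\<Sum>y<n. Q $$ (a, y) * (if b \<in> {j..<l} \<and> y = b - j then 1 else 0))"
    using ab Q by (simp add: partial_perm_def scalar_prod_def atLeast0LessThan)
  also have "\<dots> = (\<Sum>y<n. if y = b - j then (if b \<in> {j..<l} then Q $$ (a, y) else 0) else 0)"
    by (rule sum.cong) auto
  also have "\<dots> = (if b \<in> {j..<l} then Q $$ (a, b - j) else 0)"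
    using bj by simp
  also have "\<dots> = (if a \<in> {j..<l} \<and> b \<in> {j..<l} then ?D $$ (a - j, b - j) else 0)"
    using ND[OF bj, folded Q_def] by simp
  also have "\<dots> = fdiag r c h $$ (a, b)"
    using ab assms by (auto simp: fdiag_def)
  finally show "fdiag r c h $$ (a, b) = (?N * ?D * transpose_mat ?M) $$ (a, b)" unfolding Q_def by simp
qed auto

lemma zero_pad_append_zeros: "zero_pad (xs @ replicate k 0) = zero_pad xs"
  by (rule ext) (auto simp: zero_pad_def nth_append)

lemma sorted_wrt_ge_append_zeros:
  "sorted_wrt (\<ge>) xs \<Longrightarrow> (\<And>s. s \<in> set xs \<Longrightarrow> 0 \<le> s) \<Longrightarrow> sorted_wrt (\<ge>) (xs @ replicate k (0 :: real))"
  by (auto simp: sorted_wrt_append sorted_wrt_iff_nth_less[of _ "replicate k _"])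

text \<open>Appended zeros vanish under \<open>zero_pad\<close>, so the small block \<open>E\<close>
  and its embedding into an m by n matrix have the same norm.\<close>

lemma uin_rect_diag_pad:
  assumes uin: "unitarily_invariant_norm \<nu>"
    and "sorted_wrt (\<ge>) xs" "\<And>s. s \<in> set xs \<Longrightarrow> 0 \<le> s" "length xs \<le> min m n"
  shows "\<nu> (rect_diag m n (xs @ replicate (min m n - length xs) 0)) = \<nu> (rect_diag (length xs) (length xs) xs)"
proof (rule uin_singular_values[OF uin])
  have "singular_values (rect_diag m n (xs @ replicate (min m n - length xs) 0)) =
      xs @ replicate (min m n - length xs) 0"
    using assms(2-4) by (intro singular_values_rect_diag sorted_wrt_ge_append_zeros) auto
  moreover have "singular_values (rect_diag (length xs) (length xs) xs) = xs"
    using assms(2-4) by (intro singular_values_rect_diag) auto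
  ultimately show "zero_pad (singular_values (rect_diag m n (xs @ replicate (min m n - length xs) 0))) =
      zero_pad (singular_values (rect_diag (length xs) (length xs) xs))"
    by (simp add: zero_pad_append_zeros)
qed

text \<open>The estimate in terms of matrix products. \<open>S\<close> and \<open>T\<close> stand
  for the selections, \<open>L\<close> and \<open>N\<close> for the left inverses whose norms give
  the two factors, and \<open>X\<^sub>p\<close> for the pseudoinverse of \<open>X\<close>. The
  bounds \<open>1 \<le> a\<close> and \<open>1 \<le> b\<close> allow the passage from the
  idempotents to their complements.\<close>

lemma truncated_cur_bound:
  assumes A: "A \<in> carrier_mat m n"
    and S: "S \<in> carrier_mat r m" "op_bounded 1 S"
    and T: "T \<in> carrier_mat n k"
    and QC: "Q\<^sub>C \<in> carrier_mat m k" "op_bounded 1 Q\<^sub>C"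
    and QX: "Q\<^sub>X \<in> carrier_mat n k" "op_bounded 1 Q\<^sub>X"
    and Tb: "op_bounded 1 T"
    and Y: "Y \<in> carrier_mat k k" "A * T = Q\<^sub>C * Y"
    and L: "L \<in> carrier_mat k r" "L * (S * Q\<^sub>C) = 1\<^sub>m k" "op_bounded a L" "1 \<le> a"
    and N: "N \<in> carrier_mat k k" "N * (transpose_mat T * Q\<^sub>X) = 1\<^sub>m k" "op_bounded b N" "1 \<le> b"
    and X: "X = Z * transpose_mat Q\<^sub>X" "Z \<in> carrier_mat k k"
    and Xp: "X\<^sub>p \<in> carrier_mat n k"
    and svd: "is_svd (S * (A * T)) U \<sigma> V"
    and eps: "0 < \<epsilon>" and le: "r \<le> m" "k \<le> n"
    and G': "G' = V * fdiag k r (\<lambda>i. inverse (if \<sigma> ! i < \<epsilon> then 0 else \<sigma> ! i)) * transpose_mat U"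
    and E: "E = (let \<tau> = filter (\<lambda>s. s < \<epsilon>) \<sigma> in rect_diag (length \<tau>) (length \<tau>) \<tau>)"
    and uin: "unitarily_invariant_norm \<nu>"
  shows "\<nu> (A - A * T * G' * (S * A)) \<le> a * b * (\<nu> (A - A * X\<^sub>p * X) + \<nu> E)"
proof -
  define G where "G = S * (A * T)"
  have G: "G \<in> carrier_mat r k" unfolding G_def using S A T by auto
  note svd = is_svdD[OF svd[folded G_def] G]
  define g where "g = (\<lambda>i. inverse (if \<sigma> ! i < \<epsilon> then 0 else \<sigma> ! i))"
  have G'c: "G' \<in> carrier_mat k r" unfolding G' using svd(1,3) by auto
  have sig0: "0 \<le> \<sigma> ! i" if "i < r" "i < k" for i using svd(5,6) that by simp
  have Geq: "G = U * fdiag r k (\<lambda>i. \<sigma> ! i) * transpose_mat V"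
    using svd(8) unfolding rect_diag_fdiag .
  note G'eq = G'[folded g_def]
  define P where "P = A * T * G' * S"
  define R where "R = T * transpose_mat N * transpose_mat Q\<^sub>X"
  define B where "B = A - A * X\<^sub>p * X"
  define W where "W = transpose_mat N * transpose_mat Q\<^sub>X"
  note dims = carrier_matD[OF A] carrier_matD[OF S(1)] carrier_matD[OF T] carrier_matD[OF QC(1)]
    carrier_matD[OF QX(1)] carrier_matD[OF Y(1)] carrier_matD[OF L(1)] carrier_matD[OF N(1)]
    carrier_matD[OF X(2)] carrier_matD[OF Xp] carrier_matD[OF svd(1)] carrier_matD[OF svd(3)]
    carrier_matD[OF G] carrier_matD[OF G'c]
  have Pc: "P \<in> carrier_mat m m" and Rc: "R \<in> carrier_mat n n" and Bc: "B \<in> carrier_mat m n"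
    and Wc: "W \<in> carrier_mat k n"
    unfolding P_def R_def B_def W_def X(1) by (intro carrier_matI; simp add: dims)+
  note dims = dims carrier_matD[OF Pc] carrier_matD[OF Rc] carrier_matD[OF Bc] carrier_matD[OF Wc]
  have LG: "A * T = Q\<^sub>C * (L * G)"
  proof -
    have "L * G = L * (S * Q\<^sub>C) * Y"
      unfolding G_def Y(2) by (simp add: dims mult_mat_assoc del: assoc_mult_mat)
    then show ?thesis using L(2) Y by simp
  qed
  \<comment> \<open>The diagonal entries are 1 at retained and 0 at discarded singular values, so
    this is an orthogonal projection.\<close>
  have GG': "G * G' = U * fdiag r r (\<lambda>i. if i < k then \<sigma> ! i * g i else 0) * transpose_mat U"
  proof -
    have "G * G' = U * (fdiag r k (\<lambda>i. \<sigma> ! i) * fdiag k r g) * transpose_mat U"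
      unfolding Geq G'eq by (simp add: dims svd(4) mult_mat_assoc orthonormal_cols_cancel del: assoc_mult_mat)
    then show ?thesis unfolding fdiag_mult .
  qed
  have gs: "\<bar>\<sigma> ! i * g i\<bar> \<le> 1" "g i * \<sigma> ! i * g i = g i" if "i < r" "i < k" for i
    using sig0[OF that] by (cases "\<sigma> ! i = 0"; simp add: g_def)+
  have op_U: "op_bounded 1 U" "op_bounded 1 (transpose_mat U)" "op_bounded 1 V" "op_bounded 1 (transpose_mat V)"
    using svd(2,4) orthonormal_cols_op_bounded op_bounded_transpose by auto
  have "op_bounded 1 (fdiag r r (\<lambda>i. if i < k then \<sigma> ! i * g i else 0))"
    by (rule op_bounded_fdiag) (use gs in auto)
  then have "op_bounded (1 * 1 * 1) (G * G')"
    unfolding GG' by (intro op_bounded_mult op_U) (simp_all add: dims)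
  then have GG'b: "op_bounded 1 (G * G')" by simp
  \<comment> \<open>Bounding the factors in the definition of \<open>P\<close> separately would
    bring in the norms of \<open>C\<close> and \<open>G'\<close>; in this form the bound is just
    \<open>a\<close>.\<close>
  have Peq: "P = Q\<^sub>C * L * (G * G') * S"
    unfolding P_def LG by (simp add: dims mult_mat_assoc del: assoc_mult_mat)
  have "op_bounded (1 * a * 1 * 1) P"
    unfolding Peq by (intro op_bounded_mult QC(2) L(3) S(2) GG'b) (simp_all add: dims)
  then have Pb: "op_bounded a P" by simp
  \<comment> \<open>\<open>G'\<close> is the pseudoinverse of the truncated matrix and not of
    \<open>G\<close>, but the discarded singular values of \<open>G\<close> meet zeros of
    \<open>G'\<close>.\<close>
  have G'GG': "G' * G * G' = G'"
  proof -
    have "G' * G * G' = V * (fdiag k r g * fdiag r k (\<lambda>i. \<sigma> ! i) * fdiag k r g) * transpose_mat U"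
      unfolding Geq G'eq by (simp add: dims svd(2,4) mult_mat_assoc orthonormal_cols_cancel del: assoc_mult_mat)
    also have "fdiag k r g * fdiag r k (\<lambda>i. \<sigma> ! i) * fdiag k r g = fdiag k r g"
      unfolding fdiag_mult by (rule fdiag_cong) (use gs in auto)
    finally show ?thesis unfolding G'eq .
  qed
  have "P * P = A * T * (G' * G * G') * S"
    unfolding P_def G_def by (simp add: dims mult_mat_assoc del: assoc_mult_mat)
  then have PP: "P * P = P" unfolding G'GG' P_def .
  have P1b: "op_bounded a (1\<^sub>m m - P)"
    by (rule op_bounded_complement_idempotent[OF Pc PP Pb L(4)])
  have QTN: "transpose_mat Q\<^sub>X * (T * transpose_mat N) = 1\<^sub>m k"
    using arg_cong[OF N(2), of transpose_mat]
    by (simp add: dims transpose_mat_mult mult_mat_assoc del: assoc_mult_mat)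
  have "R * R = T * transpose_mat N * (transpose_mat Q\<^sub>X * (T * transpose_mat N)) * transpose_mat Q\<^sub>X"
    unfolding R_def by (simp add: dims mult_mat_assoc del: assoc_mult_mat)
  also have "\<dots> = R" unfolding QTN R_def by (simp add: dims)
  finally have RR: "R * R = R" .
  have "op_bounded (1 * b * 1) R"
    unfolding R_def by (intro op_bounded_mult op_bounded_transpose Tb N(3) QX(2)) (simp_all add: dims)
  then have Rb: "op_bounded b R" by simp
  have R1b: "op_bounded b (1\<^sub>m n - R)"
    by (rule op_bounded_complement_idempotent[OF Rc RR Rb N(4)])
  have "X * R = Z * (transpose_mat Q\<^sub>X * (T * transpose_mat N)) * transpose_mat Q\<^sub>X"
    unfolding R_def X(1) by (simp add: dims mult_mat_assoc del: assoc_mult_mat)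
  also have "\<dots> = X" unfolding QTN X(1) by (simp add: dims)
  finally have XR: "X * R = X" .
  have Xd: "dim_row X = k" "dim_col X = n" unfolding X(1) by (simp_all add: dims)
  \<comment> \<open>By \<open>X * R = X\<close> the terms with \<open>X\<^sub>p\<close>
    cancel.\<close>
  have BR: "B * (1\<^sub>m n - R) = A - A * R"
  proof -
    have "B * (1\<^sub>m n - R) = B - B * R"
      by (simp add: dims mult_mat_minus_distrib del: assoc_mult_mat)
    also have "B * R = A * R - A * X\<^sub>p * X"
      unfolding B_def by (simp add: dims Xd minus_mat_mult_distrib mult_mat_assoc XR del: assoc_mult_mat)
    also have "B - (A * R - A * X\<^sub>p * X) = A - A * R"
      unfolding B_def by (rule eq_matI) (simp_all add: dims Xd del: index_mult_mat(1))
    finally show ?thesis .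
  qed
  have split: "A - A * T * G' * (S * A) = (1\<^sub>m m - P) * B * (1\<^sub>m n - R) + (1\<^sub>m m - P) * (A * R)"
  proof -
    have "(1\<^sub>m m - P) * B * (1\<^sub>m n - R) = (1\<^sub>m m - P) * (A - A * R)"
      by (subst mult_mat_assoc) (simp_all add: dims BR)
    also have "\<dots> = (1\<^sub>m m - P) * A - (1\<^sub>m m - P) * (A * R)"
      by (rule mult_mat_minus_distrib) (simp_all add: dims)
    finally have "(1\<^sub>m m - P) * B * (1\<^sub>m n - R) + (1\<^sub>m m - P) * (A * R) = (1\<^sub>m m - P) * A"
      by (intro eq_matI) (simp_all add: dims del: index_mult_mat(1))
    also have "\<dots> = A - P * A" by (simp add: dims minus_mat_mult_distrib)
    also have "P * A = A * T * G' * (S * A)"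
      unfolding P_def by (simp add: dims mult_mat_assoc del: assoc_mult_mat)
    finally show ?thesis by simp
  qed
  have term1: "\<nu> ((1\<^sub>m m - P) * B * (1\<^sub>m n - R)) \<le> a * b * \<nu> B"
    using L(4) N(4) Pc Rc by (intro uin_mult_both[OF uin _ P1b _ Bc _ R1b]) (auto intro: minus_carrier_mat)

  \<comment> \<open>The second term and the discarded singular values\<close>
  define h where "h = (\<lambda>i. if \<sigma> ! i < \<epsilon> then \<sigma> ! i else 0)"
  define l where "l = min r k"
  define \<tau> where "\<tau> = filter (\<lambda>s. s < \<epsilon>) \<sigma>"
  \<comment> \<open>The list decreases, so \<open>j\<close> counts the retained singular values, and
    the discarded ones occupy the positions from \<open>j\<close> up to, but excluding,
    \<open>l\<close>.\<close>
  define j where "j = l - length \<tau>"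
  have lens: "length \<sigma> = l" "length \<tau> \<le> l" using svd(5) unfolding l_def \<tau>_def
    by (auto intro: order_trans[OF length_filter_le])
  have tau: "\<tau> = drop j \<sigma>"
    using filter_less_drop[OF svd(7), of \<epsilon>] lens unfolding \<tau>_def j_def by simp
  have hj: "h i = (if i < j then 0 else \<sigma> ! i)" if "i < l" for i
    using nth_less_iff_filter[OF svd(7), of i \<epsilon>] that lens unfolding h_def j_def \<tau>_def by auto
  \<comment> \<open>\<open>G * G' * G\<close> is the truncated matrix, so the difference keeps
    exactly the discarded part. Here \<open>0 < \<epsilon>\<close> ensures that only nonzero values
    are inverted.\<close>
  have GGG: "G - G * G' * G = U * fdiag r k h * transpose_mat V"
  proof -
    have "G * G' * G = U * (fdiag r k (\<lambda>i. \<sigma> ! i) * fdiag k r g * fdiag r k (\<lambda>i. \<sigma> ! i)) * transpose_mat V"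
      unfolding Geq G'eq by (simp add: dims svd(2,4) mult_mat_assoc orthonormal_cols_cancel del: assoc_mult_mat)
    also have "fdiag r k (\<lambda>i. \<sigma> ! i) * fdiag k r g * fdiag r k (\<lambda>i. \<sigma> ! i) = fdiag r k (\<lambda>i. \<sigma> ! i - h i)"
      unfolding fdiag_mult by (rule fdiag_cong) (use eps in \<open>auto simp: g_def h_def\<close>)
    finally have "G - G * G' * G = U * (fdiag r k (\<lambda>i. \<sigma> ! i) - fdiag r k (\<lambda>i. \<sigma> ! i - h i)) * transpose_mat V"
      unfolding Geq by (simp add: dims mult_mat_minus_distrib minus_mat_mult_distrib del: assoc_mult_mat)
    then show ?thesis unfolding fdiag_minus by simp
  qed
  \<comment> \<open>These move the discarded block to the top left corner of an m by n matrix, where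
    it becomes the padded form \<open>F\<close> of \<open>E\<close>. The outer factors then become
    square, as \<open>uin_mult_both\<close> requires.\<close>
  define M1 where "M1 = partial_perm r m {j..<l} (\<lambda>i. i - j) (\<lambda>_. 1)"
  define M2 where "M2 = partial_perm k n {j..<l} (\<lambda>i. i - j) (\<lambda>_. 1)"
  have M1: "M1 \<in> carrier_mat r m" "op_bounded 1 M1"
    unfolding M1_def by (auto intro!: op_bounded_partial_perm inj_onI simp: l_def) (use le in auto)
  have M2: "M2 \<in> carrier_mat k n" "op_bounded 1 M2"
    unfolding M2_def by (auto intro!: op_bounded_partial_perm inj_onI simp: l_def) (use le in auto)
  define F where "F = rect_diag m n (\<tau> @ replicate (min m n - length \<tau>) 0)"
  have F: "F \<in> carrier_mat m n" unfolding F_def by simp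
  have "fdiag r k h = M1 * fdiag m n (\<lambda>i. if j + i < l then h (j + i) else 0) * transpose_mat M2"
    unfolding M1_def M2_def
    by (rule fdiag_shift[OF _ le]) (subst hj, auto simp: j_def l_def)
  also have "fdiag m n (\<lambda>i. if j + i < l then h (j + i) else 0) = F"
    unfolding F_def rect_diag_fdiag
  proof (rule fdiag_cong)
    fix i assume i: "i < min m n"
    have *: "i < length \<tau> \<longleftrightarrow> j + i < l" "j \<le> length \<sigma>" using lens unfolding j_def by auto
    show "(if j + i < l then h (j + i) else 0) = (\<tau> @ replicate (min m n - length \<tau>) 0) ! i"
    proof (cases "j + i < l")
      case False
      then have "i - length \<tau> < min m n - length \<tau>" using i * by linarith
      then show ?thesis using False * by (simp add: nth_append del: min_less_iff_conj)
    qed (use hj[of "j + i"] * in \<open>simp add: nth_append, simp add: tau\<close>)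
  qed
  finally have hF: "fdiag r k h = M1 * F * transpose_mat M2" .
  note dims = dims carrier_matD[OF M1(1)] carrier_matD[OF M2(1)] carrier_matD[OF F]
  have "(1\<^sub>m m - P) * (A * R) = (1\<^sub>m m - P) * (A * T) * W"
    unfolding R_def W_def by (simp add: dims mult_mat_assoc del: assoc_mult_mat)
  also have "(1\<^sub>m m - P) * (A * T) = A * T - P * (A * T)"
    by (simp add: dims minus_mat_mult_distrib)
  also have "P * (A * T) = Q\<^sub>C * L * (G * G' * G)"
    unfolding Peq G_def by (simp add: dims mult_mat_assoc del: assoc_mult_mat)
  also have "A * T - Q\<^sub>C * L * (G * G' * G) = Q\<^sub>C * L * (G - G * G' * G)"
    unfolding LG by (simp add: dims mult_mat_minus_distrib mult_mat_assoc del: assoc_mult_mat)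
  also have "\<dots> = Q\<^sub>C * L * U * M1 * F * (transpose_mat M2 * transpose_mat V)"
    unfolding GGG hF by (simp add: dims mult_mat_assoc del: assoc_mult_mat)
  finally have term2_eq: "(1\<^sub>m m - P) * (A * R) =
      Q\<^sub>C * L * U * M1 * F * (transpose_mat M2 * transpose_mat V * transpose_mat N * transpose_mat Q\<^sub>X)"
    unfolding W_def by (simp add: dims mult_mat_assoc del: assoc_mult_mat)
  have left: "op_bounded (1 * a * 1 * 1) (Q\<^sub>C * L * U * M1)" "Q\<^sub>C * L * U * M1 \<in> carrier_mat m m"
    by (intro op_bounded_mult carrier_matI QC(2) L(3) op_U M1(2); simp add: dims)+
  have right: "op_bounded (1 * 1 * b * 1) (transpose_mat M2 * transpose_mat V * transpose_mat N * transpose_mat Q\<^sub>X)"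
    "transpose_mat M2 * transpose_mat V * transpose_mat N * transpose_mat Q\<^sub>X \<in> carrier_mat n n"
    by (intro op_bounded_mult op_bounded_transpose carrier_matI M2(2) op_U(3) N(3) QX(2); simp add: dims)+
  have "\<nu> ((1\<^sub>m m - P) * (A * R)) \<le> a * b * \<nu> F"
    unfolding term2_eq using left right L(4) N(4) by (intro uin_mult_both[OF uin _ _ _ F]) auto
  also have "\<nu> F = \<nu> E"
    unfolding F_def E Let_def \<tau>_def[symmetric]
    by (rule uin_rect_diag_pad[OF uin])
      (use svd(6,7) lens le in \<open>auto simp: l_def tau dest: in_set_dropD intro: sorted_wrt_drop\<close>)
  finally have term2: "\<nu> ((1\<^sub>m m - P) * (A * R)) \<le> a * b * \<nu> E" .
  have "\<nu> (A - A * T * G' * (S * A)) \<le>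
      \<nu> ((1\<^sub>m m - P) * B * (1\<^sub>m n - R)) + \<nu> ((1\<^sub>m m - P) * (A * R))"
    unfolding split by (rule uin_triangle[OF uin, of _ m n]) (intro carrier_matI; simp add: dims)+
  also have "\<dots> \<le> a * b * \<nu> B + a * b * \<nu> E" using term1 term2 by simp
  finally show ?thesis unfolding B_def by (simp add: distrib_left)
qed

text \<open>Each column of \<open>B\<close> is a combination of columns of \<open>A\<close>; the
  coefficient vectors, placed side by side, form \<open>Y\<close>.\<close>

lemma col_space_factor:
  fixes A B :: "real mat"
  assumes A: "A \<in> carrier_mat n k" and B: "B \<in> carrier_mat n l"
    and sub: "vec_space.col_space n B \<subseteq> vec_space.col_space n A"
  obtains Y where "Y \<in> carrier_mat k l" and "B = A * Y"
proof -
  interpret vec_space "TYPE(real)" n .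
  have "\<exists>x \<in> carrier_vec k. A *\<^sub>v x = col B j" if "j < l" for j
  proof -
    have "B *\<^sub>v unit_vec l j = col B j" using B that by (rule mult_mat_unit_vec)
    then have "col B j \<in> col_space B"
      unfolding col_space_eq[OF B] using B that by (auto intro!: bexI[of _ "unit_vec l j"])
    then show ?thesis using sub A unfolding col_space_eq[OF A] by auto
  qed
  then obtain x where x: "\<And>j. j < l \<Longrightarrow> x j \<in> carrier_vec k \<and> A *\<^sub>v x j = col B j" by metis
  define Y where "Y = mat k l (\<lambda>(i, j). x j $ i)"
  have Y: "Y \<in> carrier_mat k l" unfolding Y_def by simp
  moreover have "B = A * Y"
  proof (rule mat_col_eqI)
    fix j assume "j < dim_col (A * Y)"
    then have j: "j < l" using Y by simp
    have "col Y j = x j" using j x[OF j] by (intro eq_vecI) (auto simp: Y_def)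
    then show "col B j = col (A * Y) j" using x[OF j] col_mult2[OF A Y j] by simp
  qed (use A B Y in auto)
  ultimately show ?thesis using that by blast
qed

text \<open>The identity of positive size fixes a unit vector, and its norm is at most
  \<open>a * 1\<close>. This provides the lower bounds that \<open>truncated_cur_bound\<close> asks
  for.\<close>

lemma left_inverse_bound_ge_1:
  assumes M: "M \<in> carrier_mat r k" "op_bounded 1 M" and L: "L \<in> carrier_mat k r" "op_bounded a L" "0 \<le> a"
    and LM: "L * M = 1\<^sub>m k" and k: "0 < k"
  shows "1 \<le> a"
proof -
  have "op_bounded (a * 1) (1\<^sub>m k)"
    using op_bounded_mult[OF _ L(2) M(2)] L(1) M(1) LM by simp
  then have "unit_vec k 0 \<bullet> unit_vec k 0 \<le> a\<^sup>2 * (unit_vec k 0 \<bullet> (unit_vec k 0 :: real vec))"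
    using op_boundedD[of a "1\<^sub>m k" k k "unit_vec k 0"] by simp
  then have "1 \<le> a\<^sup>2" using k by simp
  then show ?thesis using L(3) power2_le_imp_le[of 1 a] by simp
qed

text \<open>Used to carry a left inverse for the rows in \<open>I\<close> over to the larger set
  \<open>K\<close>.\<close>

lemma submatrix_row_selection_subset:
  assumes "I \<subseteq> K" and K: "K \<subseteq> {0..<m}"
  obtains H where "H \<in> carrier_mat (card I) (card K)" and "row_selection m I = H * row_selection m K"
proof -
  \<comment> \<open>\<open>f i\<close> is the position inside \<open>K\<close> of the element of
    \<open>I\<close> at position \<open>i\<close>.\<close>
  define f where "f = (\<lambda>i. card {a \<in> K. a < pick I i})"
  define H where "H = partial_perm (card I) (card K) {..<card I} f (\<lambda>_. 1)"
  have finK: "finite K" using K finite_subset by blast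
  have pI: "pick I i \<in> K" if "i < card I" for i
    using pick_in_set[of i I] that assms(1) by auto
  have f: "f i < card K" "pick K (f i) = pick I i" if "i < card I" for i
  proof -
    have "{a \<in> K. a < pick I i} \<subset> K" using pI[OF that] by auto
    then show "f i < card K" unfolding f_def by (rule psubset_card_mono[OF finK])
    show "pick K (f i) = pick I i" unfolding f_def by (rule pick_card_in_set[OF pI[OF that]])
  qed
  have "row_selection m I = H * row_selection m K"
  proof (rule eq_matI)
    fix i j assume "i < dim_row (H * row_selection m K)" "j < dim_col (H * row_selection m K)"
    then have ij: "i < card I" "j < m" unfolding H_def by auto
    have "(H * row_selection m K) $$ (i, j) = row_selection m K $$ (f i, j)"
      unfolding H_def using ij f by (subst partial_perm_mult_index) auto
    then show "row_selection m I $$ (i, j) = (H * row_selection m K) $$ (i, j)"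
      using ij f[OF ij(1)] by (simp add: row_selection_def partial_perm_def)
  qed (auto simp: H_def)
  then show ?thesis using that[of H] by (simp add: H_def)
qed

text \<open>For square matrices a one-sided inverse is two-sided, so the factors of a product equal
  to 1 may be rotated cyclically.\<close>

lemma square_factor_left_inverse:
  fixes M N D :: "real mat"
  assumes M: "M \<in> carrier_mat k k" and N: "N \<in> carrier_mat k k" and D: "D \<in> carrier_mat k k"
    and "M * N * D = 1\<^sub>m k"
  shows "N * D * M = 1\<^sub>m k" and "D * M * N = 1\<^sub>m k"
proof -
  have "M * (N * D) = 1\<^sub>m k" using assms by (simp add: mult_mat_assoc)
  then show "N * D * M = 1\<^sub>m k"
    using mat_mult_left_right_inverse[of M k "N * D"] M N D by simp
  have "D * (M * N) = 1\<^sub>m k"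
    using mat_mult_left_right_inverse[of "M * N" k D] M N D assms(4) by simp
  then show "D * M * N = 1\<^sub>m k" using M N D by (simp add: mult_mat_assoc)
qed

text \<open>A left inverse makes \<open>M\<close> a unit of the matrix ring, which rules out the
  result \<open>None\<close>.\<close>

lemma mat_inverse_the:
  fixes M N :: "real mat"
  assumes M: "M \<in> carrier_mat k k" and N: "N \<in> carrier_mat k k" and "N * M = 1\<^sub>m k"
  shows "the (mat_inverse M) \<in> carrier_mat k k" and "the (mat_inverse M) * M = 1\<^sub>m k"
proof -
  have "M * N = 1\<^sub>m k" using mat_mult_left_right_inverse[OF N M assms(3)] .
  then have "M \<in> Units (ring_mat TYPE(real) k ())"
    using assms unfolding Units_def ring_mat_simps by auto
  then obtain B where "mat_inverse M = Some B" using mat_inverse(1)[OF M, where b = "()"] by (cases "mat_inverse M") auto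
  then show "the (mat_inverse M) \<in> carrier_mat k k" "the (mat_inverse M) * M = 1\<^sub>m k"
    using mat_inverse(2)[OF M] by auto
qed

text \<open>The decomposition is taken from the choice inside \<open>sv_truncate\<close> itself, so
  that it fits the truncated matrix by construction.\<close>

lemma sv_truncate_svd:
  assumes B: "B \<in> carrier_mat r c"
  obtains U \<sigma> V where "is_svd B U \<sigma> V"
    and "pinv (sv_truncate \<epsilon> B) =
      V * fdiag c r (\<lambda>i. inverse (if \<sigma> ! i < \<epsilon> then 0 else \<sigma> ! i)) * transpose_mat U"
proof -
  let ?P = "\<lambda>B'. \<exists>U \<sigma> V. is_svd B U \<sigma> V \<and>
     B' = U * rect_diag (dim_row B) (dim_col B) (map (\<lambda>s. if s < \<epsilon> then 0 else s) \<sigma>) * transpose_mat V"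
  obtain U \<sigma> V where "is_svd B U \<sigma> V" by (rule svd_exists)
  then have "\<exists>B'. ?P B'" by blast
  then have "?P (sv_truncate \<epsilon> B)" unfolding sv_truncate_def by (rule someI_ex)
  then obtain U \<sigma> V where svd: "is_svd B U \<sigma> V"
    and eq: "sv_truncate \<epsilon> B = U * rect_diag r c (map (\<lambda>s. if s < \<epsilon> then 0 else s) \<sigma>) * transpose_mat V"
    using B by auto
  note svdD = is_svdD[OF svd B]
  have "rect_diag r c (map (\<lambda>s. if s < \<epsilon> then 0 else s) \<sigma>) = fdiag r c (\<lambda>i. if \<sigma> ! i < \<epsilon> then 0 else \<sigma> ! i)"
    unfolding rect_diag_fdiag by (rule fdiag_cong) (use svdD(5) in simp)
  then have "pinv (sv_truncate \<epsilon> B) =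
      V * fdiag c r (\<lambda>i. inverse (if \<sigma> ! i < \<epsilon> then 0 else \<sigma> ! i)) * transpose_mat U"
    unfolding eq using pinv_orthonormal_fdiag[OF svdD(1-4)] by simp
  then show ?thesis by (rule that[OF svd])
qed

theorem theorem3p3:
  fixes A X Q\<^sub>C Q\<^sub>X :: "real mat" and m n k p k\<^sub>\<epsilon> :: nat and I J I\<^sub>0 :: "nat set" and \<epsilon> :: real
  assumes "A \<in> carrier_mat m n"
    and "I \<subseteq> {0..<m}" and "J \<subseteq> {0..<n}"
    and "card I = k" and "card J = k"
    and "1 \<le> k" and "k \<le> vec_space.rank m A"
    and "0 < \<epsilon>"
    and "X \<in> carrier_mat k n"
    and "invertible_mat (submatrix A I J)"
    and "vec_space.rank k (submatrix X UNIV J) = k"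
    and "I\<^sub>0 \<subseteq> {0..<m}" and "I \<inter> I\<^sub>0 = {}" and "card I\<^sub>0 = p"
    and "Q\<^sub>C \<in> carrier_mat m k" and "orthonormal_cols Q\<^sub>C"
    and "vec_space.col_space m Q\<^sub>C = vec_space.col_space m (submatrix A UNIV J)"
    and "Q\<^sub>X \<in> carrier_mat n k" and "orthonormal_cols Q\<^sub>X"
    and "vec_space.col_space n Q\<^sub>X = vec_space.col_space n (transpose_mat X)"
    and "k\<^sub>\<epsilon> = length (filter (\<lambda>s. s < \<epsilon>) (singular_values (submatrix A (I \<union> I\<^sub>0) J)))"
  shows "k\<^sub>\<epsilon> \<le> k \<and>
    (\<exists>E \<in> carrier_mat k\<^sub>\<epsilon> k\<^sub>\<epsilon>. spectral_norm E \<le> \<epsilon> \<and>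
      (\<forall>\<nu>. unitarily_invariant_norm \<nu> \<longrightarrow>
        \<nu> (A - cur_approx A \<epsilon> (I \<union> I\<^sub>0) J)
          \<le> spectral_norm (pinv (submatrix Q\<^sub>C (I \<union> I\<^sub>0) UNIV))
             * spectral_norm (the (mat_inverse (submatrix Q\<^sub>X J UNIV)))
             * (\<nu> (A - A * pinv X * X) + \<nu> E)))"
proof -
  define K where "K = I \<union> I\<^sub>0"
  define r where "r = card K"
  define S where "S = row_selection m K"
  define SI where "SI = row_selection m I"
  define T where "T = transpose_mat (row_selection n J)"
  define C where "C = A * T"
  define G where "G = S * C"
  have K: "K \<subseteq> {0..<m}" "I \<subseteq> K" using assms(2,12) unfolding K_def by auto
  have rm: "r \<le> m" using card_mono[OF _ K(1)] unfolding r_def by simp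
  have kn: "k \<le> n" using card_mono[OF _ assms(3)] assms(5) by simp
  have S: "S \<in> carrier_mat r m" "op_bounded 1 S"
    unfolding S_def r_def using op_bounded_row_selection[OF K(1)] by auto
  have SI: "SI \<in> carrier_mat k m"
    unfolding SI_def using row_selection_carrier(1)[of m I] assms(4) by simp
  have T: "T \<in> carrier_mat n k" "op_bounded 1 T"
    unfolding T_def using row_selection_carrier(1)[of n J] assms(5)
      op_bounded_transpose[OF op_bounded_row_selection[OF assms(3)]] by auto
  have C: "C \<in> carrier_mat m k" unfolding C_def using assms(1) T by auto
  have G: "G \<in> carrier_mat r k" unfolding G_def using S C by auto
  have subA: "submatrix A UNIV J = C" "submatrix A K J = G" "submatrix A K UNIV = S * A"
    "submatrix A I J = SI * C"
    unfolding C_def G_def S_def SI_def T_def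
    using submatrix_cols[OF assms(1,3)] submatrix_rows[OF assms(1) K(1)]
      submatrix_rows_cols[OF assms(1) K(1) assms(3)] submatrix_rows_cols[OF assms(1-3)] by auto

  \<comment> \<open>The selected rows of \<open>Q\<^sub>C\<close> and their pseudoinverse\<close>
  obtain Y where Y: "Y \<in> carrier_mat k k" "C = Q\<^sub>C * Y"
    using col_space_factor[OF assms(15) C] assms(17) unfolding subA by auto
  obtain D where D: "SI * C * D = 1\<^sub>m k" "D \<in> carrier_mat k k"
  proof -
    obtain D where D: "inverts_mat (SI * C) D" "inverts_mat D (SI * C)"
      using assms(10) unfolding subA invertible_mat_def by blast
    have "SI * C * D = 1\<^sub>m k" "D * (SI * C) = 1\<^sub>m (dim_row D)"
      using D SI C unfolding inverts_mat_def by auto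
    moreover from this have "dim_col D = k" "dim_row D = k"
      using SI C by (metis index_mult_mat(3) index_one_mat(3) carrier_matD(2))+
    ultimately show ?thesis using that by blast
  qed
  obtain H where H: "H \<in> carrier_mat k r" "SI = H * S"
    using submatrix_row_selection_subset[OF K(2,1)] assms(4) unfolding S_def SI_def r_def by metis
  \<comment> \<open>The nonsingular matrix A(I,J) factors through the rows \<open>I\<close> of
    \<open>Q\<^sub>C\<close>, so these rows have the inverse \<open>Y * D\<close>; composed with
    \<open>H\<close> it is a left inverse for the rows \<open>K\<close>.\<close>
  have "SI * Q\<^sub>C * Y * D = 1\<^sub>m k"
    using D(1) SI Y assms(15) unfolding Y(2) by (simp add: mult_mat_assoc)
  then have "Y * D * (SI * Q\<^sub>C) = 1\<^sub>m k"
    by (rule square_factor_left_inverse(1)[rotated 3]) (use SI Y D assms(15) in auto)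
  then have Lf: "Y * D * H * (S * Q\<^sub>C) = 1\<^sub>m k"
    unfolding H(2) using Y(1) D(2) H(1) S(1) assms(15) by (simp add: mult_mat_assoc)
  define L where "L = pinv (S * Q\<^sub>C)"
  have SQ: "S * Q\<^sub>C \<in> carrier_mat r k" "op_bounded 1 (S * Q\<^sub>C)"
    using S assms(15) op_bounded_mult[OF _ S(2) orthonormal_cols_op_bounded[OF assms(16)]] by auto
  have L: "L \<in> carrier_mat k r" "S * Q\<^sub>C * L * (S * Q\<^sub>C) = S * Q\<^sub>C"
    using penrose_pinv[of "S * Q\<^sub>C", unfolded penrose_def carrier_matD[OF SQ(1)]]
    unfolding L_def by blast+
  \<comment> \<open>Given some left inverse, the first Penrose equation makes the pseudoinverse a
    left inverse as well.\<close>
  have LSQ: "L * (S * Q\<^sub>C) = 1\<^sub>m k"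
  proof -
    have "L * (S * Q\<^sub>C) = Y * D * H * (S * Q\<^sub>C) * (L * (S * Q\<^sub>C))"
      unfolding Lf using L(1) SQ(1) by simp
    also have "\<dots> = Y * D * H * (S * Q\<^sub>C * L * (S * Q\<^sub>C))"
      using Y(1) D(2) H(1) S(1) assms(15) L(1) by (simp add: mult_mat_assoc del: assoc_mult_mat)
    finally show ?thesis unfolding L(2) Lf .
  qed

  \<comment> \<open>The selected rows of \<open>Q\<^sub>X\<close> and their inverse\<close>
  obtain Z where Z: "Z \<in> carrier_mat k k" "transpose_mat X = Q\<^sub>X * Z"
    using col_space_factor[OF assms(18), of "transpose_mat X" k] assms(9,20) by auto
  have X: "X = transpose_mat Z * transpose_mat Q\<^sub>X"
    using arg_cong[OF Z(2), of transpose_mat] Z(1) assms(18) by (simp add: transpose_mat_mult)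
  have subX: "submatrix X UNIV J = X * T" "submatrix Q\<^sub>X J UNIV = transpose_mat T * Q\<^sub>X"
    unfolding T_def using submatrix_cols[OF assms(9,3)] submatrix_rows[OF assms(18,3)] by auto
  have XT: "X * T \<in> carrier_mat k k" using assms(9) T by auto
  have "det (X * T) \<noteq> 0"
    using vec_space.det_rank_iff[OF XT] assms(11) unfolding subX by simp
  then have "X * T \<in> Units (ring_mat TYPE(real) k ())"
    by (rule det_non_zero_imp_unit[OF XT])
  then obtain D' where D': "X * T * D' = 1\<^sub>m k" "D' \<in> carrier_mat k k"
    unfolding Units_def ring_mat_simps by auto
  have TX: "transpose_mat T * Q\<^sub>X \<in> carrier_mat k k" using T assms(18) by auto
  have TQ: "transpose_mat Q\<^sub>X * T \<in> carrier_mat k k" using T assms(18) by auto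
  \<comment> \<open>X(:,J) is invertible by its rank and has the square factor
    \<open>Q\<^sub>X\<^sup>T T\<close>, so this factor is invertible; transposition gives the rows
    \<open>J\<close> of \<open>Q\<^sub>X\<close>.\<close>
  have "transpose_mat Z * (transpose_mat Q\<^sub>X * T) * D' = 1\<^sub>m k"
    using D' Z(1) T(1) assms(18) unfolding X by (simp add: mult_mat_assoc)
  then have "D' * transpose_mat Z * (transpose_mat Q\<^sub>X * T) = 1\<^sub>m k"
    by (rule square_factor_left_inverse(2)[rotated 3]) (use Z D' TQ in auto)
  then have "transpose_mat Q\<^sub>X * T * (D' * transpose_mat Z) = 1\<^sub>m k"
    using mat_mult_left_right_inverse[of "D' * transpose_mat Z" k "transpose_mat Q\<^sub>X * T"] D' Z TQ by simp
  from arg_cong[OF this, of transpose_mat]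
  have "transpose_mat (D' * transpose_mat Z) * (transpose_mat T * Q\<^sub>X) = 1\<^sub>m k"
    using D'(2) Z(1) T(1) assms(18) by (simp add: transpose_mat_mult)
  then have N: "the (mat_inverse (transpose_mat T * Q\<^sub>X)) \<in> carrier_mat k k"
    "the (mat_inverse (transpose_mat T * Q\<^sub>X)) * (transpose_mat T * Q\<^sub>X) = 1\<^sub>m k"
    using mat_inverse_the[OF TX, of "transpose_mat (D' * transpose_mat Z)"] D'(2) Z(1) by auto
  define N where "N = the (mat_inverse (transpose_mat T * Q\<^sub>X))"
  note N = N[folded N_def]

  have QX: "op_bounded 1 Q\<^sub>X" using orthonormal_cols_op_bounded[OF assms(19)] .
  have TXb: "op_bounded 1 (transpose_mat T * Q\<^sub>X)"
    using op_bounded_mult[OF _ op_bounded_transpose[OF T(2)] QX] T(1) assms(18) by simp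
  have a1: "1 \<le> spectral_norm L"
    by (rule left_inverse_bound_ge_1[OF SQ L(1) op_bounded_spectral_norm spectral_norm_nonneg LSQ])
       (use assms(6) in simp)
  have b1: "1 \<le> spectral_norm N"
    by (rule left_inverse_bound_ge_1[OF TX TXb N(1) op_bounded_spectral_norm spectral_norm_nonneg N(2)])
       (use assms(6) in simp)
  have Xp: "pinv X \<in> carrier_mat n k"
    using penrose_pinv[of X] assms(9) unfolding penrose_def by auto

  \<comment> \<open>The matrix \<open>E\<close> and the conclusion\<close>
  obtain U \<sigma> V where svd: "is_svd G U \<sigma> V" and G': "pinv (sv_truncate \<epsilon> G) =
      V * fdiag k r (\<lambda>i. inverse (if \<sigma> ! i < \<epsilon> then 0 else \<sigma> ! i)) * transpose_mat U"
    by (rule sv_truncate_svd[OF G])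
  have keps: "k\<^sub>\<epsilon> = length (filter (\<lambda>s. s < \<epsilon>) \<sigma>)"
    using assms(21) singular_values_eq[OF svd] unfolding K_def[symmetric] subA by simp
  \<comment> \<open>\<open>E\<close> is built from the discarded singular values before any norm is
    chosen, so one matrix serves all \<open>\<nu>\<close>; its diagonal lies between 0 and
    \<epsilon>.\<close>
  define E where "E = rect_diag k\<^sub>\<epsilon> k\<^sub>\<epsilon> (filter (\<lambda>s. s < \<epsilon>) \<sigma>)"
  have "k\<^sub>\<epsilon> \<le> k"
    using keps is_svdD(5)[OF svd G] by (auto intro: order_trans[OF length_filter_le])
  moreover have "E \<in> carrier_mat k\<^sub>\<epsilon> k\<^sub>\<epsilon>" unfolding E_def by simp
  moreover have "spectral_norm E \<le> \<epsilon>"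
  proof (rule spectral_norm_le)
    show "op_bounded \<epsilon> E"
      unfolding E_def rect_diag_fdiag
    proof (rule op_bounded_fdiag)
      fix i assume "i < k\<^sub>\<epsilon>"
      then have "filter (\<lambda>s. s < \<epsilon>) \<sigma> ! i \<in> set (filter (\<lambda>s. s < \<epsilon>) \<sigma>)"
        unfolding keps by (rule nth_mem)
      then show "\<bar>filter (\<lambda>s. s < \<epsilon>) \<sigma> ! i\<bar> \<le> \<epsilon>" using is_svdD(6)[OF svd G] by auto
    qed
  qed (use assms(8) in simp)
  moreover have "\<nu> (A - cur_approx A \<epsilon> (I \<union> I\<^sub>0) J)
      \<le> spectral_norm (pinv (submatrix Q\<^sub>C (I \<union> I\<^sub>0) UNIV))
         * spectral_norm (the (mat_inverse (submatrix Q\<^sub>X J UNIV)))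
         * (\<nu> (A - A * pinv X * X) + \<nu> E)" if "unitarily_invariant_norm \<nu>" for \<nu>
  proof -
    have subQ: "submatrix Q\<^sub>C K UNIV = S * Q\<^sub>C"
      unfolding S_def by (rule submatrix_rows[OF assms(15) K(1)])
    show ?thesis
      unfolding K_def[symmetric] cur_approx_def subA subQ subX L_def[symmetric] N_def[symmetric]
      unfolding C_def
    proof (rule truncated_cur_bound[OF assms(1) S T(1) assms(15) orthonormal_cols_op_bounded[OF assms(16)]
          assms(18) QX T(2) Y(1) _ L(1) LSQ op_bounded_spectral_norm a1 N op_bounded_spectral_norm b1
          X _ Xp _ assms(8) rm kn G' _ that])
      show "is_svd (S * (A * T)) U \<sigma> V" using svd unfolding G_def C_def .
    qed (use Y(2) Z(1) in \<open>simp_all add: C_def E_def keps Let_def\<close>)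
  qed
  ultimately show ?thesis by blast
qed

end
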